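(* Let $w$ be an outer commutator word and let $G$ be a profinite group that has finitely many closed subgroups $G_1,G_2,\dots,G_s$ whose union contains all $w$-values in $G$. If each of the subgroups $G_1,G_2,\dots,G_s$ is of finite rank, then $w(G)$ has finite rank as well.
   Context: Outer commutator words are defined recursively: a single variable $w(x)=x$ is an outer commutator word of weight $1$; if $u$ and $v$ are outer commutator words of weights $m$ and $n$ involving disjoint sets of variables, then $[u,v]$ is an outer commutator word of weight $m+n$. Here $[x,y]=x^{-1}y^{-1}xy$. For a word $w=w(x_1,\dots,x_n)$, a $w$-value in $G$ is an element $w(g_1,\dots,g_n)$ with $g_1,\dots,g_n\in G$. For profinite groups all group-theoretic notions are interpreted topologically: "subgroup" means closed subgroup, and "generated" means topologically generated. In particular $w(G)$ is the closed subgroup topologically generated by all $w$-values in $G$. A (profinite) group is of finite rank $r$ if every (topologically) finitely generated (closed) subgroup can be (topologically) generated by $r$ elements; the rank is the least such $r$, and the group has finite rank if such an $r$ exists. *)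

theory Defs
  imports "HOL-Analysis.Abstract_Topological_Spaces" "HOL-Algebra.Generated_Groups"
begin

section \<open>Group words and outer commutator words\<close>

text \<open>Words are formal expressions in the variables \<open>x\<^sub>0, x\<^sub>1, \<dots>\<close>, not reduced elements of a free
  group; only their values in groups matter.\<close>

datatype gword = Var nat | One | Inv gword | Mult gword gword

primrec vars :: "gword \<Rightarrow> nat set" where
  "vars (Var i) = {i}"
| "vars One = {}"
| "vars (Inv u) = vars u"
| "vars (Mult u v) = vars u \<union> vars v"

definition Comm :: "gword \<Rightarrow> gword \<Rightarrow> gword" where
  "Comm u v = Mult (Mult (Mult (Inv u) (Inv v)) u) v"

text \<open>The first argument is the weight.\<close>

inductive outer_commutator_word :: "nat \<Rightarrow> gword \<Rightarrow> bool" where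
  var: "outer_commutator_word 1 (Var i)"
| comm: "outer_commutator_word m u \<Longrightarrow> outer_commutator_word n v \<Longrightarrow> vars u \<inter> vars v = {}
    \<Longrightarrow> outer_commutator_word (m + n) (Comm u v)"

primrec eval_word :: "('a, 'b) monoid_scheme \<Rightarrow> (nat \<Rightarrow> 'a) \<Rightarrow> gword \<Rightarrow> 'a" where
  "eval_word G g (Var i) = g i"
| "eval_word G g One = \<one>\<^bsub>G\<^esub>"
| "eval_word G g (Inv u) = inv\<^bsub>G\<^esub> (eval_word G g u)"
| "eval_word G g (Mult u v) = eval_word G g u \<otimes>\<^bsub>G\<^esub> eval_word G g v"

text \<open>Assignments are total on the countably many variables; those not occurring in the word
  are irrelevant to its value.\<close>

definition word_values :: "('a, 'b) monoid_scheme \<Rightarrow> gword \<Rightarrow> 'a set" where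
  "word_values G w = {eval_word G g w | g. \<forall>i. g i \<in> carrier G}"


section \<open>Profinite groups\<close>

locale topological_group = group G for G (structure) +
  fixes T :: "'a topology"
  assumes topspace_eq_carrier: "topspace T = carrier G"
    and continuous_mult: "continuous_map (prod_topology T T) T (\<lambda>(x, y). x \<otimes> y)"
    and continuous_inv: "continuous_map T T (\<lambda>x. inv x)"

locale profinite_group = topological_group +
  assumes compact: "compact_space T"
    and Hausdorff: "Hausdorff_space T"
    and totally_disconnected: "\<And>C. C \<in> connected_components_of T \<Longrightarrow> \<exists>x. C = {x}"

definition closed_subgroup :: "'a set \<Rightarrow> ('a, 'b) monoid_scheme \<Rightarrow> 'a topology \<Rightarrow> bool" where
  "closed_subgroup H G T \<longleftrightarrow> subgroup H G \<and> closedin T H"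

definition top_generate :: "('a, 'b) monoid_scheme \<Rightarrow> 'a topology \<Rightarrow> 'a set \<Rightarrow> 'a set" where
  "top_generate G T S = T closure_of (generate G S)"

definition verbal_subgroup :: "('a, 'b) monoid_scheme \<Rightarrow> 'a topology \<Rightarrow> gword \<Rightarrow> 'a set" where
  "verbal_subgroup G T w = top_generate G T (word_values G w)"


section \<open>Rank\<close>

text \<open>``Generated by \<open>r\<close> elements'' allows repetitions, hence \<open>card S \<le> r\<close>.\<close>

definition rank_at_most :: "('a, 'b) monoid_scheme \<Rightarrow> 'a topology \<Rightarrow> nat \<Rightarrow> bool" where
  "rank_at_most G T r \<longleftrightarrow>
     (\<forall>H. closed_subgroup H G T \<and>
          (\<exists>S. S \<subseteq> carrier G \<and> finite S \<and> top_generate G T S = H) \<longrightarrow>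
          (\<exists>S. S \<subseteq> carrier G \<and> finite S \<and> card S \<le> r \<and> top_generate G T S = H))"

definition finite_rank :: "('a, 'b) monoid_scheme \<Rightarrow> 'a topology \<Rightarrow> bool" where
  "finite_rank G T \<longleftrightarrow> (\<exists>r. rank_at_most G T r)"

text \<open>A closed subgroup is a topological group in its own right, with the subspace topology.\<close>

definition subgroup_finite_rank :: "'a set \<Rightarrow> ('a, 'b) monoid_scheme \<Rightarrow> 'a topology \<Rightarrow> bool" where
  "subgroup_finite_rank H G T \<longleftrightarrow> finite_rank (G\<lparr>carrier := H\<rparr>) (subtopology T H)"

end

theory Submission
  imports Defs
begin

text \<open>For a set \<open>I\<close> of variables of \<open>w\<close>, one seeks an open normal subgroup \<open>K\<close> such that the values of
  \<open>w\<close> with entries from \<open>K\<close> at the positions in \<open>I\<close> (and arbitrary entries elsewhere) lie in a closed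
  normal subgroup \<open>N\<close> of finite rank. This is done by downward induction on \<open>I\<close>. If it holds for all
  larger sets then, modulo \<open>N\<close>, such a value depends only on the cosets modulo \<open>K\<close> of its entries outside
  \<open>I\<close>, so finitely many patterns of cosets remain. For each pattern, one of the covering subgroups
  contains all values on some open box of tuples, as the covering sets are closed and finite in number.
  An outer commutator word is linear in each variable up to conjugation of its entries and of its value;
  hence the cosets at the positions in \<open>I\<close> can be moved, one at a time, to an open normal subgroup itself.
  If \<open>I\<close> is nonempty, the values for each pattern generate a subgroup of \<open>K\<close> that is normalized by \<open>K\<close>,
  and the product of these finitely many subgroups has finite rank. For \<open>I\<close> empty the same
  reasoning shows that \<open>w\<close> has only finitely many values modulo some \<open>N\<close>; modulo \<open>N\<close> they generate
  a finitely generated group with a centre of finite index, and so \<open>w(G)\<close> has finite rank.\<close>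

section \<open>Values of outer commutator words\<close>

text \<open>The covering subgroups are not assumed normal, so a conjugator in front of a value
  cannot be absorbed by them; this shapes the argument. Linearity writes a conjugate of a value with
  \<open>y\<close> at position \<open>i\<close> as the quotient of two values whose entries at
  \<open>i\<close> are \<open>y g_i\<close> and \<open>g_i\<close>. If \<open>y\<close> is trivial
  modulo the open normal subgroup \<open>M\<close> defining a box, both lie in the same covering
  subgroup, hence so does the quotient; that moves the box at \<open>i\<close> to \<open>M\<close>.
  The conjugator is shifted onto the entries. It lies in \<open>K\<close>, so the cosets modulo
  \<open>K\<close> of the other entries survive, and this needs the entry at \<open>i\<close> to lie
  in \<open>K\<close> already. Nonemptiness of \<open>I\<close> puts the values themselves into
  \<open>K\<close>: then the subgroups for the patterns, each normalized by \<open>K\<close>,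
  normalize one another and their product is a subgroup. Without a restricted entry this is lost,
  and finiteness of the set of values modulo \<open>N\<close> takes its place. All work modulo
  \<open>N\<close> is done with cosets in \<open>G\<close>; the quotient is never made into a
  topological group.\<close>

lemma finite_vars: "finite (vars w)"
  by (induction w) auto

lemma vars_Comm [simp]: "vars (Comm u v) = vars u \<union> vars v"
  by (auto simp: Comm_def)

lemma eval_Comm:
  "eval_word G g (Comm u v) = inv\<^bsub>G\<^esub> eval_word G g u \<otimes>\<^bsub>G\<^esub> inv\<^bsub>G\<^esub> eval_word G g v
     \<otimes>\<^bsub>G\<^esub> eval_word G g u \<otimes>\<^bsub>G\<^esub> eval_word G g v"
  by (simp add: Comm_def)

lemma eval_word_cong:
  "(\<And>j. j \<in> vars w \<Longrightarrow> g j = g' j) \<Longrightarrow> eval_word G g w = eval_word G g' w"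
  by (induction w) auto

context group
begin

lemma inv_mult_cancel [simp]:
  "x \<in> carrier G \<Longrightarrow> y \<in> carrier G \<Longrightarrow> inv x \<otimes> (x \<otimes> y) = y"
  "x \<in> carrier G \<Longrightarrow> y \<in> carrier G \<Longrightarrow> x \<otimes> (inv x \<otimes> y) = y"
  by (simp_all add: m_assoc[symmetric])

lemma eval_word_closed [simp]:
  "(\<And>j. g j \<in> carrier G) \<Longrightarrow> eval_word G g w \<in> carrier G"
  by (induction w) auto

lemma eval_word_conj:
  assumes "\<And>j. g j \<in> carrier G" "x \<in> carrier G"
  shows "eval_word G (\<lambda>j. x \<otimes> g j \<otimes> inv x) w = x \<otimes> eval_word G g w \<otimes> inv x"
  by (induction w) (auto simp: assms m_assoc inv_mult_group)

text \<open>A commutator with a factor in a normal subgroup lies in that subgroup, so one entry in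
  \<open>K\<close> forces the whole value into \<open>K\<close>. Conjugators built from such values
  therefore stay in \<open>K\<close>.\<close>

lemma eval_word_normal:
  assumes "outer_commutator_word n w" "K \<lhd> G" "\<And>j. g j \<in> carrier G" "i \<in> vars w" "g i \<in> K"
  shows "eval_word G g w \<in> K"
  using assms(1,4)
proof (induction)
  case (var j)
  then show ?case using assms by simp
next
  case (comm m u n v)
  interpret K: normal K G by fact
  let ?u = "eval_word G g u" and ?v = "eval_word G g v"
  have c: "?u \<in> carrier G" "?v \<in> carrier G"
    using assms(3) by auto
  consider "?u \<in> K" | "?v \<in> K"
    using comm by auto
  then show ?case
  proof cases
    case 1
    then have "inv ?u \<otimes> (inv ?v \<otimes> ?u \<otimes> ?v) \<in> K"
      using K.inv_op_closed1[OF c(2)] by auto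
    then show ?thesis
      using c by (simp add: eval_Comm m_assoc)
  next
    case 2
    then have "(inv ?u \<otimes> inv ?v \<otimes> ?u) \<otimes> ?v \<in> K"
      using K.inv_op_closed1[OF c(1), of "inv ?v"] by auto
    then show ?thesis
      using c by (simp add: eval_Comm m_assoc)
  qed
qed

text \<open>This is the inductive step of \<open>linearise\<close> for a variable of the left
  factor. Here \<open>x\<close> and \<open>y\<close> are the values of the two factors,
  \<open>e\<close> conjugates \<open>x\<close> into a quotient of two values \<open>a\<close> and
  \<open>b\<close>, and \<open>z\<close> is what \<open>e\<close> makes of the other factor.\<close>

lemma commutator_div_left:
  assumes "a \<in> carrier G" "b \<in> carrier G" "z \<in> carrier G" "e \<in> carrier G"
    and x: "inv e \<otimes> x \<otimes> e = a \<otimes> inv b" "x \<in> carrier G"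
    and y: "z = inv e \<otimes> y \<otimes> e" "y \<in> carrier G"
  shows "inv (e \<otimes> b) \<otimes> (inv x \<otimes> inv y \<otimes> x \<otimes> y) \<otimes> (e \<otimes> b)
    = (inv a \<otimes> inv z \<otimes> a \<otimes> z) \<otimes> inv (inv b \<otimes> inv z \<otimes> b \<otimes> z)"
proof -
  have "x = e \<otimes> (inv e \<otimes> x \<otimes> e) \<otimes> inv e"
    using assms(4) x(2) by (simp add: m_assoc)
  then have xe: "x = e \<otimes> (a \<otimes> inv b) \<otimes> inv e"
    using x by simp
  have ye: "y = e \<otimes> z \<otimes> inv e"
    using assms(4) y by (simp add: m_assoc)
  show ?thesis
    unfolding xe ye using assms(1-4) by (simp add: m_assoc inv_mult_group)
qed

text \<open>Conjugation by \<open>e \<otimes> b\<close> alone gives \<open>inv B\<close> on the left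
  of the commutator of \<open>z\<close> and \<open>a\<close>. Conjugating once more by
  \<open>inv B\<close> carries it to the right, the shape \<open>value \<otimes> inv value\<close>
  that the induction on words has to reproduce.\<close>

lemma commutator_div_right:
  assumes "a \<in> carrier G" "b \<in> carrier G" "z \<in> carrier G" "e \<in> carrier G"
    and x: "inv e \<otimes> x \<otimes> e = a \<otimes> inv b" "x \<in> carrier G"
    and y: "z = inv e \<otimes> y \<otimes> e" "y \<in> carrier G"
  defines "B \<equiv> inv z \<otimes> inv b \<otimes> z \<otimes> b"
  shows "inv (e \<otimes> b \<otimes> inv B) \<otimes> (inv y \<otimes> inv x \<otimes> y \<otimes> x) \<otimes> (e \<otimes> b \<otimes> inv B)
    = (inv z \<otimes> inv a \<otimes> z \<otimes> a) \<otimes> inv B"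
proof -
  have "x = e \<otimes> (inv e \<otimes> x \<otimes> e) \<otimes> inv e"
    using assms(4) x(2) by (simp add: m_assoc)
  then have xe: "x = e \<otimes> (a \<otimes> inv b) \<otimes> inv e"
    using x by simp
  have ye: "y = e \<otimes> z \<otimes> inv e"
    using assms(4) y by (simp add: m_assoc)
  show ?thesis
    unfolding xe ye B_def using assms(1-4) by (simp add: m_assoc inv_mult_group)
qed

end

section \<open>Linearity in one variable, up to conjugation\<close>

context group_hom
begin

lemma hom_eval_word:
  assumes "\<And>j. g j \<in> carrier G"
  shows "h (eval_word G g w) = eval_word H (\<lambda>j. h (g j)) w"
  by (induction w) (auto simp: assms)

lemma hom_eval_word_cong:
  assumes "\<And>j. g j \<in> carrier G" "\<And>j. g' j \<in> carrier G" "\<And>j. j \<in> vars w \<Longrightarrow> h (g j) = h (g' j)"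
  shows "h (eval_word G g w) = h (eval_word G g' w)"
  using assms by (auto simp: hom_eval_word intro: eval_word_cong)

text \<open>The identities behind this are \<open>[ab\<inverse>, z]\<^sup>b = [a, z] [b, z]\<inverse>\<close> and
  \<open>[z, ab\<inverse>]\<^sup>b = [z, b]\<inverse> [z, a]\<close>. It is used with \<open>h\<close> the projection modulo an open normal
  subgroup, where only the cosets of the entries are prescribed, and with \<open>h\<close> the identity.\<close>

lemma linearise:
  assumes "outer_commutator_word n w" "i \<in> vars w" and K: "K \<lhd> G"
    and b: "\<And>j. b j \<in> carrier G" and bi: "b i \<in> K"
  shows "\<exists>b' d. d \<in> K \<and> (\<forall>j. \<exists>e\<in>K. b' j = e \<otimes> b j \<otimes> inv e) \<and>
    (\<forall>g y. (\<forall>j. g j \<in> carrier G) \<longrightarrow> y \<in> carrier G \<longrightarrow> (\<forall>j\<in>vars w - {i}. h (g j) = h (b' j)) \<longrightarrow>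
      (\<exists>g' d'. (\<forall>j. g' j \<in> carrier G) \<and> d' \<in> carrier G \<and> h d' = h d \<and>
        (\<forall>j\<in>vars w. h (g' j) = h (b j)) \<and>
        inv d' \<otimes> eval_word G (g(i := y)) w \<otimes> d'
          = eval_word G (g'(i := y \<otimes> g' i)) w \<otimes> inv eval_word G g' w))"
  using assms(1,2)
proof (induction)
  case (var k)
  interpret K: normal K G by (rule K)
  have "\<exists>e\<in>K. b j = e \<otimes> b j \<otimes> inv e" for j
    using b by (intro bexI[of _ \<one>]) auto
  moreover have "\<exists>g' d'. (\<forall>j. g' j \<in> carrier G) \<and> d' \<in> carrier G \<and> h d' = h \<one> \<and>
        (\<forall>j\<in>vars (Var k). h (g' j) = h (b j)) \<and>
        inv d' \<otimes> eval_word G (g(i := y)) (Var k) \<otimes> d'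
          = eval_word G (g'(i := y \<otimes> g' i)) (Var k) \<otimes> inv eval_word G g' (Var k)"
    if "y \<in> carrier G" for g :: "nat \<Rightarrow> 'a" and y
    using b that var by (intro exI[of _ b] exI[of _ \<one>]) (auto simp: G.m_assoc)
  ultimately show ?case
    by (intro exI[of _ b] exI[of _ \<one>]) auto
next
  case (comm m u n v)
  interpret K: normal K G by (rule K)
  have disj: "j \<in> vars v \<Longrightarrow> j \<notin> vars u" for j
    using comm.hyps by blast
  have Kc: "x \<in> K \<Longrightarrow> x \<in> carrier G" for x
    using K.subset by blast
  from comm.prems consider (u) "i \<in> vars u" "i \<notin> vars v" | (v) "i \<in> vars v" "i \<notin> vars u"
    using disj by auto
  then show ?case
  proof cases
    case u
    obtain b1 d1 where d1: "d1 \<in> K" and b1: "\<And>j. \<exists>e\<in>K. b1 j = e \<otimes> b j \<otimes> inv e"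
      and IH: "\<forall>g y. (\<forall>j. g j \<in> carrier G) \<longrightarrow> y \<in> carrier G \<longrightarrow> (\<forall>j\<in>vars u - {i}. h (g j) = h (b1 j)) \<longrightarrow>
      (\<exists>g' d'. (\<forall>j. g' j \<in> carrier G) \<and> d' \<in> carrier G \<and> h d' = h d1 \<and>
        (\<forall>j\<in>vars u. h (g' j) = h (b j)) \<and>
        inv d' \<otimes> eval_word G (g(i := y)) u \<otimes> d'
          = eval_word G (g'(i := y \<otimes> g' i)) u \<otimes> inv eval_word G g' u)"
      using comm.IH(1)[OF u(1)] by (elim exE conjE) (rule that, assumption, erule spec)
    define U where "U = eval_word G b u"
    \<comment> \<open>The entries of \<open>v\<close> are conjugated by \<open>d1\<close> in
      advance: the conjugator \<open>e\<close> supplied later agrees with \<open>d1\<close> under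
      \<open>h\<close>, so undoing the conjugation with \<open>e\<close> brings the image of each
      entry back to that of \<open>b\<close>.\<close>
    define b' where "b' j = (if j \<in> vars u then b1 j else d1 \<otimes> b j \<otimes> inv d1)" for j
    have UK: "U \<in> K"
      unfolding U_def using G.eval_word_normal[OF comm.hyps(1) K, of b i] b bi u by simp
    have b'e: "\<exists>e\<in>K. b' j = e \<otimes> b j \<otimes> inv e" for j
      using b1[of j] d1 by (auto simp: b'_def)
    have "\<exists>g' d'. (\<forall>j. g' j \<in> carrier G) \<and> d' \<in> carrier G \<and> h d' = h (d1 \<otimes> U) \<and>
        (\<forall>j\<in>vars (Comm u v). h (g' j) = h (b j)) \<and>
        inv d' \<otimes> eval_word G (g(i := y)) (Comm u v) \<otimes> d'
          = eval_word G (g'(i := y \<otimes> g' i)) (Comm u v) \<otimes> inv eval_word G g' (Comm u v)"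
      if g: "\<forall>j. g j \<in> carrier G" and y: "y \<in> carrier G"
        and gb: "\<forall>j\<in>vars (Comm u v) - {i}. h (g j) = h (b' j)" for g y
    proof -
      have "\<forall>j\<in>vars u - {i}. h (g j) = h (b1 j)"
        using gb by (auto simp: b'_def)
      from IH[THEN spec, THEN spec, THEN mp, OF g, THEN mp, OF y, THEN mp, OF this] obtain g1 e where g1: "\<And>j. g1 j \<in> carrier G" and e: "e \<in> carrier G"
        and he: "h e = h d1" and g1b: "\<And>j. j \<in> vars u \<Longrightarrow> h (g1 j) = h (b j)"
        and eq: "inv e \<otimes> eval_word G (g(i := y)) u \<otimes> e
          = eval_word G (g1(i := y \<otimes> g1 i)) u \<otimes> inv eval_word G g1 u"
        by blast
      define g' where "g' j = (if j \<in> vars u then g1 j else inv e \<otimes> g j \<otimes> e)" for j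
      have g'c: "g' j \<in> carrier G" for j
        using g1 g e by (auto simp: g'_def)
      have E1: "eval_word G g' u = eval_word G g1 u"
        by (rule eval_word_cong) (simp add: g'_def)
      have E2: "eval_word G (g'(i := y \<otimes> g' i)) u = eval_word G (g1(i := y \<otimes> g1 i)) u"
        by (rule eval_word_cong) (use u in \<open>simp add: g'_def\<close>)
      have E3: "eval_word G g' v = inv e \<otimes> eval_word G g v \<otimes> e"
      proof -
        have "eval_word G g' v = eval_word G (\<lambda>j. inv e \<otimes> g j \<otimes> inv (inv e)) v"
          by (rule eval_word_cong) (use disj e in \<open>simp add: g'_def\<close>)
        then show ?thesis
          using g e G.eval_word_conj[of g "inv e" v] by simp
      qed
      have E4: "eval_word G (g'(i := y \<otimes> g' i)) v = eval_word G g' v"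
        by (rule eval_word_cong) (use u in auto)
      have E5: "eval_word G (g(i := y)) v = eval_word G g v"
        by (rule eval_word_cong) (use u in auto)
      have "h (g' j) = h (b j)" if j: "j \<in> vars (Comm u v)" for j
      proof (cases "j \<in> vars u")
        case False
        then have "j \<in> vars (Comm u v) - {i}"
          using j u by auto
        then have "h (g j) = h (d1 \<otimes> b j \<otimes> inv d1)"
          using bspec[OF gb, of j] False by (simp add: b'_def)
        then show ?thesis
          using False g e b Kc[OF d1] by (simp add: g'_def he H.m_assoc)
      qed (simp add: g'_def g1b)
      moreover have "h (e \<otimes> eval_word G g1 u) = h (d1 \<otimes> U)"
        using e g1 Kc[OF d1] he hom_eval_word_cong[of g1 b u] g1b b by (simp add: U_def)
      moreover have "inv (e \<otimes> eval_word G g1 u) \<otimes> eval_word G (g(i := y)) (Comm u v) \<otimes> (e \<otimes> eval_word G g1 u)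
          = eval_word G (g'(i := y \<otimes> g' i)) (Comm u v) \<otimes> inv eval_word G g' (Comm u v)"
        unfolding eval_Comm E1 E2 E4 E5
        by (rule G.commutator_div_left[OF _ _ _ _ eq _ E3]) (use g y e g1 g'c in auto)
      ultimately show ?thesis
        using g'c e g1 by (intro exI[of _ g'] exI[of _ "e \<otimes> eval_word G g1 u"]) auto
    qed
    note key = this
    have "d1 \<otimes> U \<in> K"
      using UK d1 by auto
    with b'e key show ?thesis
      by - (rule exI[of _ b'], rule exI[of _ "d1 \<otimes> U"], intro conjI allI impI)
  next
    case v
    obtain b1 d1 where d1: "d1 \<in> K" and b1: "\<And>j. \<exists>e\<in>K. b1 j = e \<otimes> b j \<otimes> inv e"
      and IH: "\<forall>g y. (\<forall>j. g j \<in> carrier G) \<longrightarrow> y \<in> carrier G \<longrightarrow> (\<forall>j\<in>vars v - {i}. h (g j) = h (b1 j)) \<longrightarrow>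
      (\<exists>g' d'. (\<forall>j. g' j \<in> carrier G) \<and> d' \<in> carrier G \<and> h d' = h d1 \<and>
        (\<forall>j\<in>vars v. h (g' j) = h (b j)) \<and>
        inv d' \<otimes> eval_word G (g(i := y)) v \<otimes> d'
          = eval_word G (g'(i := y \<otimes> g' i)) v \<otimes> inv eval_word G g' v)"
      using comm.IH(2)[OF v(1)] by (elim exE conjE) (rule that, assumption, erule spec)
    define V where "V = eval_word G b v"
    define W where "W = eval_word G b (Comm u v)"
    define b' where "b' j = (if j \<in> vars v then b1 j else d1 \<otimes> b j \<otimes> inv d1)" for j
    have VK: "V \<in> K"
      unfolding V_def using G.eval_word_normal[OF comm.hyps(2) K, of b i] b bi v by simp
    have WK: "W \<in> K"
      unfolding W_def 
      using G.eval_word_normal[OF outer_commutator_word.comm[OF comm.hyps] K, of b i] b bi v by simp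
    have b'e: "\<exists>e\<in>K. b' j = e \<otimes> b j \<otimes> inv e" for j
      using b1[of j] d1 by (auto simp: b'_def)
    have "\<exists>g' d'. (\<forall>j. g' j \<in> carrier G) \<and> d' \<in> carrier G \<and> h d' = h (d1 \<otimes> V \<otimes> inv W) \<and>
        (\<forall>j\<in>vars (Comm u v). h (g' j) = h (b j)) \<and>
        inv d' \<otimes> eval_word G (g(i := y)) (Comm u v) \<otimes> d'
          = eval_word G (g'(i := y \<otimes> g' i)) (Comm u v) \<otimes> inv eval_word G g' (Comm u v)"
      if g: "\<forall>j. g j \<in> carrier G" and y: "y \<in> carrier G"
        and gb: "\<forall>j\<in>vars (Comm u v) - {i}. h (g j) = h (b' j)" for g y
    proof -
      have "\<forall>j\<in>vars v - {i}. h (g j) = h (b1 j)"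
        using gb by (auto simp: b'_def)
      from IH[THEN spec, THEN spec, THEN mp, OF g, THEN mp, OF y, THEN mp, OF this] obtain g1 e where g1: "\<And>j. g1 j \<in> carrier G" and e: "e \<in> carrier G"
        and he: "h e = h d1" and g1b: "\<And>j. j \<in> vars v \<Longrightarrow> h (g1 j) = h (b j)"
        and eq: "inv e \<otimes> eval_word G (g(i := y)) v \<otimes> e
          = eval_word G (g1(i := y \<otimes> g1 i)) v \<otimes> inv eval_word G g1 v"
        by blast
      define g' where "g' j = (if j \<in> vars v then g1 j else inv e \<otimes> g j \<otimes> e)" for j
      have g'c: "g' j \<in> carrier G" for j
        using g1 g e by (auto simp: g'_def)
      have E1: "eval_word G g' v = eval_word G g1 v"
        by (rule eval_word_cong) (simp add: g'_def)
      have E2: "eval_word G (g'(i := y \<otimes> g' i)) v = eval_word G (g1(i := y \<otimes> g1 i)) v"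
        by (rule eval_word_cong) (use v in \<open>simp add: g'_def\<close>)
      have E3: "eval_word G g' u = inv e \<otimes> eval_word G g u \<otimes> e"
      proof -
        have "eval_word G g' u = eval_word G (\<lambda>j. inv e \<otimes> g j \<otimes> inv (inv e)) u"
          by (rule eval_word_cong) (use disj e in \<open>auto simp add: g'_def\<close>)
        then show ?thesis
          using g e G.eval_word_conj[of g "inv e" u] by simp
      qed
      have E4: "eval_word G (g'(i := y \<otimes> g' i)) u = eval_word G g' u"
        by (rule eval_word_cong) (use v in auto)
      have E5: "eval_word G (g(i := y)) u = eval_word G g u"
        by (rule eval_word_cong) (use v in auto)
      have g'b: "h (g' j) = h (b j)" if j: "j \<in> vars (Comm u v)" for j
      proof (cases "j \<in> vars v")
        case False
        then have "j \<in> vars (Comm u v) - {i}"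
          using j v by auto
        then have "h (g j) = h (d1 \<otimes> b j \<otimes> inv d1)"
          using bspec[OF gb, of j] False by (simp add: b'_def)
        then show ?thesis
          using False g e b Kc[OF d1] by (simp add: g'_def he H.m_assoc)
      qed (simp add: g'_def g1b)
      \<comment> \<open>The last factor is the correction from \<open>commutator_div_right\<close>.
        As \<open>g'\<close> agrees with \<open>b\<close> under \<open>h\<close>, its image is that
        of \<open>inv W\<close>, and \<open>W\<close> is in \<open>K\<close>.\<close>
      define d' where "d' = e \<otimes> eval_word G g' v \<otimes> inv eval_word G g' (Comm u v)"
      have "h d' = h (d1 \<otimes> V \<otimes> inv W)"
        using e g'c Kc[OF d1] he hom_eval_word_cong[of g' b "Comm u v"] b
          hom_eval_word_cong[of g' b v] g'b by (simp add: V_def W_def d'_def)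
      moreover have "inv d' \<otimes> eval_word G (g(i := y)) (Comm u v) \<otimes> d'
          = eval_word G (g'(i := y \<otimes> g' i)) (Comm u v) \<otimes> inv eval_word G g' (Comm u v)"
        unfolding d'_def eval_Comm E1 E2 E4 E5
        by (rule G.commutator_div_right[OF _ _ _ _ eq _ E3]) (use g y e g1 g'c in auto)
      moreover have "d' \<in> carrier G"
        using e g'c by (simp add: d'_def)
      ultimately show ?thesis
        using g'c g'b by (intro exI[of _ g'] exI[of _ d']) auto
    qed
    note key = this
    have "d1 \<otimes> V \<otimes> inv W \<in> K"
      using VK WK d1 by auto
    with b'e key show ?thesis
      by - (rule exI[of _ b'], rule exI[of _ "d1 \<otimes> V \<otimes> inv W"], intro conjI allI impI)
  qed
qed

text \<open>Take \<open>g\<close> near \<open>b'\<close> and apply \<open>linearise\<close> with the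
  entry of \<open>g\<close> at \<open>i\<close>, up to conjugation, as \<open>y\<close>. Since
  \<open>h\<close> kills it, the two values in the resulting quotient come from tuples that
  \<open>h\<close> cannot distinguish from \<open>b\<close>, so they lie in \<open>R\<close>; as
  \<open>R\<close> is a subgroup, so does their quotient.\<close>

lemma linear_step:
  assumes w: "outer_commutator_word n w" "i \<in> vars w" and K: "K \<lhd> G"
    and b: "\<And>j. b j \<in> carrier G" and bi: "b i \<in> K" and R: "subgroup R G"
    and bR: "\<And>g. (\<And>j. g j \<in> carrier G) \<Longrightarrow> (\<And>j. j \<in> vars w \<Longrightarrow> h (g j) = h (b j)) \<Longrightarrow> eval_word G g w \<in> R"
  shows "\<exists>b'. b' i = \<one> \<and> (\<forall>j. j \<noteq> i \<longrightarrow> (\<exists>e\<in>K. b' j = e \<otimes> b j \<otimes> inv e)) \<and>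
    (\<forall>g. (\<forall>j. g j \<in> carrier G) \<longrightarrow> (\<forall>j\<in>vars w. h (g j) = h (b' j)) \<longrightarrow> eval_word G g w \<in> R)"
proof -
  interpret K: normal K G by (rule K)
  interpret R: subgroup R G by (rule R)
  have Kc: "x \<in> K \<Longrightarrow> x \<in> carrier G" for x
    using K.subset by blast
  obtain b' d where d: "d \<in> K" and b'e: "\<And>j. \<exists>e\<in>K. b' j = e \<otimes> b j \<otimes> inv e"
    and lin: "\<forall>g y. (\<forall>j. g j \<in> carrier G) \<longrightarrow> y \<in> carrier G \<longrightarrow> (\<forall>j\<in>vars w - {i}. h (g j) = h (b' j)) \<longrightarrow>
      (\<exists>g' d'. (\<forall>j. g' j \<in> carrier G) \<and> d' \<in> carrier G \<and> h d' = h d \<and>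
        (\<forall>j\<in>vars w. h (g' j) = h (b j)) \<and>
        inv d' \<otimes> eval_word G (g(i := y)) w \<otimes> d'
          = eval_word G (g'(i := y \<otimes> g' i)) w \<otimes> inv eval_word G g' w)"
    using linearise[where b = b, OF w K b bi] by (elim exE conjE) (rule that, assumption, erule spec)
  have dc: "d \<in> carrier G"
    using d Kc by auto
  have b'c: "b' j \<in> carrier G" for j
    using b'e[of j] b[of j] Kc by auto
  \<comment> \<open>The conjugator \<open>d\<close> of \<open>linearise\<close> is undone by
    conjugating the whole tuple. At position \<open>i\<close> any element killed by \<open>h\<close>
    would serve, so \<open>\<one>\<close> is taken.\<close>
  define b2 where "b2 = (\<lambda>j. inv d \<otimes> b' j \<otimes> d)(i := \<one>)"
  have "eval_word G g w \<in> R" if g: "\<forall>j. g j \<in> carrier G" and gb: "\<forall>j\<in>vars w. h (g j) = h (b2 j)" for g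
  proof -
    define f where "f j = d \<otimes> g j \<otimes> inv d" for j
    have fc: "\<forall>j. f j \<in> carrier G"
      using g dc by (auto simp: f_def)
    have "\<forall>j\<in>vars w - {i}. h (f j) = h (b' j)"
    proof
      fix j assume "j \<in> vars w - {i}"
      then have "h (g j) = h (inv d \<otimes> b' j \<otimes> d)"
        using gb by (auto simp: b2_def)
      then show "h (f j) = h (b' j)"
        using g dc b'c by (simp add: f_def H.m_assoc)
    qed
    from lin[THEN spec, THEN spec, THEN mp, OF fc, THEN mp, OF fc[THEN spec, of i], THEN mp, OF this]
    obtain g' d' where g': "\<And>j. g' j \<in> carrier G" and d': "d' \<in> carrier G" "h d' = h d"
      and g'b: "\<And>j. j \<in> vars w \<Longrightarrow> h (g' j) = h (b j)"
      and eq: "inv d' \<otimes> eval_word G (f(i := f i)) w \<otimes> d'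
          = eval_word G (g'(i := f i \<otimes> g' i)) w \<otimes> inv eval_word G g' w"
      by blast
    \<comment> \<open>\<open>d'\<close> is known only up to the kernel of \<open>h\<close>, and the
      discrepancy \<open>c\<close> need not normalize \<open>R\<close>. Conjugation by
      \<open>c\<close> is applied to the entries instead, where \<open>h\<close> does not see
      it.\<close>
    define c where "c = inv d \<otimes> d'"
    have c: "c \<in> carrier G" "h c = \<one>\<^bsub>H\<^esub>"
      using d' dc by (auto simp: c_def)
    let ?A = "eval_word G (g'(i := f i \<otimes> g' i)) w" and ?B = "eval_word G g' w"
    have fi: "h (f i) = \<one>\<^bsub>H\<^esub>"
      using gb w(2) g dc by (auto simp: f_def b2_def)
    have conjR: "c \<otimes> eval_word G p w \<otimes> inv c \<in> R"
      if p: "\<And>j. p j \<in> carrier G" "\<And>j. j \<in> vars w \<Longrightarrow> h (p j) = h (b j)" for p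
    proof -
      have "eval_word G (\<lambda>j. c \<otimes> p j \<otimes> inv c) w \<in> R"
        using p c b by (intro bR) auto
      then show ?thesis
        using G.eval_word_conj[of p c w] p c by simp
    qed
    have "c \<otimes> ?A \<otimes> inv c \<in> R" 
      using g' fc g'b b fi by (intro conjR) auto
    moreover have "c \<otimes> ?B \<otimes> inv c \<in> R"
      using g' g'b by (intro conjR) auto
    ultimately have "(c \<otimes> ?A \<otimes> inv c) \<otimes> inv (c \<otimes> ?B \<otimes> inv c) \<in> R"
      by auto
    also have "(c \<otimes> ?A \<otimes> inv c) \<otimes> inv (c \<otimes> ?B \<otimes> inv c) = c \<otimes> (?A \<otimes> inv ?B) \<otimes> inv c"
    proof -
      have "?A \<in> carrier G" "?B \<in> carrier G"
        using g' fc by auto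
      then show ?thesis
        using c by (simp add: G.m_assoc G.inv_mult_group)
    qed
    also have "?A \<otimes> inv ?B = inv d' \<otimes> (d \<otimes> eval_word G g w \<otimes> inv d) \<otimes> d'"
    proof -
      have "eval_word G f w = d \<otimes> eval_word G g w \<otimes> inv d"
        using g dc G.eval_word_conj[of g d w] by (simp add: f_def[abs_def])
      then show ?thesis
        using eq by simp
    qed
    also have "c \<otimes> (inv d' \<otimes> (d \<otimes> eval_word G g w \<otimes> inv d) \<otimes> d') \<otimes> inv c = eval_word G g w"
      using g dc d' by (simp add: c_def G.m_assoc G.inv_mult_group)
    finally show ?thesis .
  qed
  moreover have "\<exists>e\<in>K. b2 j = e \<otimes> b j \<otimes> inv e" if j: "j \<noteq> i" for j
  proof -
    obtain e where "e \<in> K" "b' j = e \<otimes> b j \<otimes> inv e"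
      using b'e by blast
    then show ?thesis
      using d dc Kc b j by (intro bexI[of _ "inv d \<otimes> e"]) (auto simp: b2_def G.m_assoc G.inv_mult_group)
  qed
  ultimately show ?thesis
    by - (rule exI[of _ b2], auto simp: b2_def)
qed

text \<open>Each use of \<open>linear_step\<close> disturbs the other entries only by conjugation
  with elements of \<open>K\<close>. This preserves trivial image under \<open>h\<close> and
  membership in \<open>K\<close> where these are already achieved, and the coset modulo
  \<open>K\<close> everywhere else.\<close>

lemma linear_steps:
  assumes w: "outer_commutator_word n w" and K: "K \<lhd> G" and R: "subgroup R G"
    and I: "finite I" "I \<subseteq> vars w"
    and b: "\<And>j. b j \<in> carrier G" and bI: "\<And>j. j \<in> I \<Longrightarrow> b j \<in> K" 
    and bR: "\<And>g. (\<And>j. g j \<in> carrier G) \<Longrightarrow> (\<And>j. j \<in> vars w \<Longrightarrow> h (g j) = h (b j)) \<Longrightarrow> eval_word G g w \<in> R"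
  shows "\<exists>b'. (\<forall>j\<in>I. h (b' j) = \<one>\<^bsub>H\<^esub>) \<and> (\<forall>j\<in>-I. \<exists>e\<in>K. b' j = e \<otimes> b j \<otimes> inv e) \<and> (\<forall>j\<in>I. b' j \<in> K) \<and>
    (\<forall>g. (\<forall>j. g j \<in> carrier G) \<longrightarrow> (\<forall>j\<in>vars w. h (g j) = h (b' j)) \<longrightarrow> eval_word G g w \<in> R)"
  using I bI
proof (induction I rule: finite_induct)
  interpret K: normal K G by (rule K)
  case empty
  have "\<exists>e\<in>K. b j = e \<otimes> b j \<otimes> inv e" for j
    using b by (intro bexI[of _ \<one>]) auto
  then show ?case
    using bR by - (rule exI[of _ b], auto)
next
  interpret K: normal K G by (rule K)
  case (insert i I)
  have Kc: "x \<in> K \<Longrightarrow> x \<in> carrier G" for x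
    using K.subset by blast
  have iw: "i \<in> vars w" and biK: "b i \<in> K"
    using insert.prems by auto
  have "I \<subseteq> vars w" "\<And>j. j \<in> I \<Longrightarrow> b j \<in> K"
    using insert.prems by auto
  from insert.IH[OF this] obtain b1 where
    b1: "\<And>j. j \<in> I \<Longrightarrow> h (b1 j) = \<one>\<^bsub>H\<^esub>" "\<And>j. j \<notin> I \<Longrightarrow> \<exists>e\<in>K. b1 j = e \<otimes> b j \<otimes> inv e" "\<And>j. j \<in> I \<Longrightarrow> b1 j \<in> K"
    and b1R: "\<And>g. (\<forall>j. g j \<in> carrier G) \<longrightarrow> (\<forall>j\<in>vars w. h (g j) = h (b1 j)) \<longrightarrow> eval_word G g w \<in> R"
    by blast
  have b1c: "b1 j \<in> carrier G" for j
    using b1(2)[of j] b1(3)[of j] b Kc by (cases "j \<in> I") auto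
  have "b1 i \<in> K"
    using b1(2)[OF insert.hyps(2)] biK b by auto
  from linear_step[where b = b1, OF w iw K b1c this R] b1R obtain b2 where
    b2: "b2 i = \<one>" "\<And>j. j \<noteq> i \<Longrightarrow> \<exists>e\<in>K. b2 j = e \<otimes> b1 j \<otimes> inv e"
    "\<forall>g. (\<forall>j. g j \<in> carrier G) \<longrightarrow> (\<forall>j\<in>vars w. h (g j) = h (b2 j)) \<longrightarrow> eval_word G g w \<in> R"
    by blast
  have "h (b2 j) = \<one>\<^bsub>H\<^esub> \<and> b2 j \<in> K" if "j \<in> insert i I" for j
  proof (cases "j = i")
    case False
    with that have j: "j \<in> I" by auto
    obtain e where "e \<in> K" "b2 j = e \<otimes> b1 j \<otimes> inv e"
      using b2(2)[OF False] by blast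
    then show ?thesis
      using b1(1,3)[OF j] b1c[of j] Kc by (simp add: K.m_closed)
  qed (simp add: b2)
  moreover have "\<exists>e\<in>K. b2 j = e \<otimes> b j \<otimes> inv e" if j: "j \<in> - insert i I" for j
  proof -
    obtain e where e: "e \<in> K" "b2 j = e \<otimes> b1 j \<otimes> inv e"
      using b2(2)[of j] j by blast
    obtain e' where e': "e' \<in> K" "b1 j = e' \<otimes> b j \<otimes> inv e'"
      using b1(2)[of j] j by blast
    show ?thesis
      using e e' Kc b by (intro bexI[of _ "e \<otimes> e'"]) (auto simp: G.m_assoc G.inv_mult_group)
  qed
  ultimately show ?case
    using b2(3) by - (rule exI[of _ b2], auto)
qed

end

section \<open>Dependence of values on cosets of the entries\<close>

context group
begin

lemma rcos_eq_iff:
  assumes "subgroup N G" "x \<in> carrier G" "y \<in> carrier G"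
  shows "N #> x = N #> y \<longleftrightarrow> x \<otimes> inv y \<in> N"
proof -
  interpret subgroup N G by fact
  have "x \<in> N #> y \<longleftrightarrow> x \<otimes> inv y \<in> N"
    using assms by (intro rcos_module is_group)
  moreover have "N #> x = N #> y \<longleftrightarrow> x \<in> N #> y"
    using rcos_self[OF assms(2,1)] repr_independence[OF _ assms(3,1)] by blast
  ultimately show ?thesis
    by simp
qed

lemma group_hom_rcos: "N \<lhd> G \<Longrightarrow> group_hom G (G Mod N) (\<lambda>x. N #> x)"
  by (rule group_hom.intro[OF is_group normal.factorgroup_is_group group_hom_axioms.intro[OF normal.r_coset_hom_Mod]])

lemma carrier_normal: "carrier G \<lhd> G"
  by (simp add: normal_inv_iff subgroup_self)

text \<open>Multiplying the entry at \<open>j\<close> by \<open>y\<close> changes the value by the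
  quotient that \<open>linearise\<close> describes, here for the identity homomorphism and with
  \<open>carrier G\<close> as the normal subgroup. That quotient is conjugate to a value with
  \<open>y\<close> at \<open>j\<close> and conjugates of the entries of \<open>g\<close> elsewhere;
  \<open>vanish\<close> applies to it because \<open>K\<close> is normal.\<close>

lemma eval_word_modify:
  assumes w: "outer_commutator_word n w" and N: "N \<lhd> G" and K: "K \<lhd> G" and j: "j \<in> vars w"
    and vanish: "\<And>g. (\<And>i. g i \<in> carrier G) \<Longrightarrow> (\<And>i. i \<in> insert j I \<Longrightarrow> g i \<in> K) \<Longrightarrow> eval_word G g w \<in> N"
    and "j \<notin> I" and g: "\<And>i. g i \<in> carrier G" "\<And>i. i \<in> I \<Longrightarrow> g i \<in> K" and y: "y \<in> K"
  shows "eval_word G (g(j := y \<otimes> g j)) w \<otimes> inv eval_word G g w \<in> N"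
proof -
  interpret id: group_hom G G id
    by (rule group_hom.intro[OF is_group is_group]) (simp add: group_hom_axioms_def hom_def)
  interpret N: normal N G by (rule N)
  interpret K: normal K G by (rule K)
  have yc: "y \<in> carrier G"
    using y K.subset by blast
  obtain b' d where b'e: "\<And>j. \<exists>e\<in>carrier G. b' j = e \<otimes> g j \<otimes> inv e"
    and lin: "\<forall>f y. (\<forall>j. f j \<in> carrier G) \<longrightarrow> y \<in> carrier G \<longrightarrow> (\<forall>i\<in>vars w - {j}. id (f i) = id (b' i)) \<longrightarrow>
      (\<exists>g' d'. (\<forall>j. g' j \<in> carrier G) \<and> d' \<in> carrier G \<and> id d' = id d \<and>
        (\<forall>j\<in>vars w. id (g' j) = id (g j)) \<and>
        inv d' \<otimes> eval_word G (f(j := y)) w \<otimes> d'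
          = eval_word G (g'(j := y \<otimes> g' j)) w \<otimes> inv eval_word G g' w)"
    using id.linearise[where b = g, OF w j carrier_normal g(1) g(1)]
    by (elim exE conjE) (rule that, erule spec, assumption)
  have b'c: "\<forall>i. b' i \<in> carrier G"
    using b'e g by (metis inv_closed m_closed)
  from lin[THEN spec, THEN spec, THEN mp, OF b'c, THEN mp, OF yc] obtain g' d'
    where g': "\<And>j. g' j \<in> carrier G" and d': "d' \<in> carrier G"
      and g'g: "\<And>j. j \<in> vars w \<Longrightarrow> g' j = g j"
      and eq: "inv d' \<otimes> eval_word G (b'(j := y)) w \<otimes> d'
          = eval_word G (g'(j := y \<otimes> g' j)) w \<otimes> inv eval_word G g' w"
    by auto
  have "eval_word G (b'(j := y)) w \<in> N"
  proof (rule vanish)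
    show "(b'(j := y)) i \<in> K" if "i \<in> insert j I" for i
      using b'e[of i] g(2)[of i] that y K.inv_op_closed2 by auto
  qed (use b'c yc in auto)
  then have "inv d' \<otimes> eval_word G (b'(j := y)) w \<otimes> d' \<in> N"
    by (rule N.inv_op_closed1[OF d'])
  moreover have "eval_word G g' w = eval_word G g w"
    "eval_word G (g'(j := y \<otimes> g' j)) w = eval_word G (g(j := y \<otimes> g j)) w"
    using g'g j by (auto intro!: eval_word_cong)
  ultimately show ?thesis
    using eq by simp
qed

text \<open>One entry outside \<open>I\<close> is exchanged at a time. Two representatives of a
  coset of \<open>K\<close> differ by a left factor in \<open>K\<close>, which
  \<open>eval_word_modify\<close> makes invisible modulo \<open>N\<close>.\<close>

lemma eval_word_rcos_cong:
  assumes w: "outer_commutator_word n w" and N: "N \<lhd> G" and K: "K \<lhd> G" and I: "I \<subseteq> vars w"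
    and vanish: "\<And>j g. j \<in> vars w - I \<Longrightarrow> (\<And>i. g i \<in> carrier G) \<Longrightarrow> (\<And>i. i \<in> insert j I \<Longrightarrow> g i \<in> K)
      \<Longrightarrow> eval_word G g w \<in> N"
    and g: "\<And>i. g i \<in> carrier G" and f: "\<And>i. f i \<in> carrier G"
    and gI: "\<And>i. i \<in> I \<Longrightarrow> g i \<in> K" and fI: "\<And>i. i \<in> I \<Longrightarrow> f i = g i"
    and fg: "\<And>i. i \<in> vars w - I \<Longrightarrow> K #> f i = K #> g i"
  shows "N #> eval_word G f w = N #> eval_word G g w"
proof -
  interpret N: normal N G by (rule N)
  interpret K: normal K G by (rule K)
  have "N #> eval_word G (override_on g f F) w = N #> eval_word G g w"
    if "finite F" "F \<subseteq> vars w - I" for F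
    using that
  proof (induction F rule: finite_induct)
    case (insert j F)
    let ?g = "override_on g f F"
    have gc: "?g i \<in> carrier G" for i
      using g f by (simp add: override_on_def)
    have j: "j \<in> vars w" "j \<notin> I" and F: "F \<inter> I = {}"
      using insert.prems by auto
    have "eval_word G (?g(j := (f j \<otimes> inv g j) \<otimes> ?g j)) w \<otimes> inv eval_word G ?g w \<in> N"
    proof (rule eval_word_modify[OF w N K j(1) _ j(2) gc])
      show "?g i \<in> K" if "i \<in> I" for i
        using that F gI by (auto simp: override_on_def)
      show "f j \<otimes> inv g j \<in> K"
        using fg[of j] j g f by (simp add: rcos_eq_iff K.subgroup_axioms)
    qed (use vanish j in auto)
    moreover have "?g(j := (f j \<otimes> inv g j) \<otimes> ?g j) = override_on g f (insert j F)"
      using insert.hyps g f by (auto simp: override_on_def m_assoc)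
    moreover have gc': "override_on g f (insert j F) i \<in> carrier G" for i
      using g f by (simp add: override_on_def)
    ultimately have "N #> eval_word G (override_on g f (insert j F)) w = N #> eval_word G ?g w"
      using gc by (simp add: rcos_eq_iff N.subgroup_axioms)
    then show ?case
      using insert by simp
  qed simp
  from this[of "vars w - I"] have "N #> eval_word G (override_on g f (vars w - I)) w = N #> eval_word G g w"
    by (simp add: finite_vars)
  moreover have "eval_word G (override_on g f (vars w - I)) w = eval_word G f w"
    using fI by (intro eval_word_cong) (auto simp: override_on_def)
  ultimately show ?thesis by simp
qed

end

section \<open>Open normal subgroups of profinite groups\<close>

context topological_group
begin

lemma continuous_map_group_mult:
  assumes "continuous_map X T f" "continuous_map X T g"
  shows "continuous_map X T (\<lambda>x. f x \<otimes> g x)"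
proof -
  have "continuous_map X (prod_topology T T) (\<lambda>x. (f x, g x))"
    using assms by (simp add: continuous_map_paired)
  from continuous_map_compose[OF this continuous_mult] show ?thesis
    by (simp add: o_def)
qed

lemma continuous_map_group_inv:
  "continuous_map X T f \<Longrightarrow> continuous_map X T (\<lambda>x. inv f x)"
  using continuous_map_compose[OF _ continuous_inv] by (simp add: o_def)

lemma continuous_map_group_const: "c \<in> carrier G \<Longrightarrow> continuous_map X T (\<lambda>x. c)"
  by (simp add: topspace_eq_carrier)

lemmas continuous_map_group =
  continuous_map_group_mult continuous_map_group_inv continuous_map_group_const continuous_map_id[unfolded id_def]

lemma openin_vimage:
  "continuous_map T T f \<Longrightarrow> openin T A \<Longrightarrow> openin T {x \<in> carrier G. f x \<in> A}"
  using openin_continuous_map_preimage[of T T f A] by (simp add: topspace_eq_carrier)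

lemma openin_carrier: "openin T (carrier G)"
  by (metis openin_topspace topspace_eq_carrier)

lemma closedin_carrier: "closedin T A \<Longrightarrow> A \<subseteq> carrier G"
  using closedin_subset topspace_eq_carrier by blast

lemma openin_rcos:
  assumes "subgroup U G" "openin T U" "x \<in> carrier G"
  shows "openin T (U #> x)"
proof -
  have "U #> x = {y \<in> carrier G. y \<otimes> inv x \<in> U}"
    using subgroup.rcos_module[OF assms(1) is_group assms(3)] subgroup.elemrcos_carrier[OF assms(1) is_group assms(3)] by blast
  moreover have "openin T {y \<in> carrier G. y \<otimes> inv x \<in> U}"
    using assms by (intro openin_vimage continuous_map_group) auto
  ultimately show ?thesis by simp
qed

end

definition (in topological_group) open_normal :: "'a set \<Rightarrow> bool" where
  "open_normal U \<longleftrightarrow> U \<lhd> G \<and> openin T U"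

context topological_group
begin

lemma open_normal_carrier: "open_normal (carrier G)"
  by (simp add: open_normal_def carrier_normal openin_carrier)

lemma open_normal_Int: "open_normal U \<Longrightarrow> open_normal V \<Longrightarrow> open_normal (U \<inter> V)"
  by (auto simp: open_normal_def normal_subgroup_intersect)

lemma open_normal_INT:
  assumes "finite A" "\<And>a. a \<in> A \<Longrightarrow> open_normal (U a)"
  shows "\<exists>V. open_normal V \<and> (\<forall>a\<in>A. V \<subseteq> U a)"
  using assms
proof (induction A rule: finite_induct)
  case (insert a A)
  then obtain V where "open_normal V" "\<forall>a\<in>A. V \<subseteq> U a"
    by auto
  then show ?case
    using insert by (intro exI[of _ "U a \<inter> V"]) (auto simp: open_normal_Int)
qed (use open_normal_carrier in auto)

lemma open_normalD:
  assumes "open_normal U"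
  shows "U \<lhd> G" "subgroup U G" "openin T U" "U \<subseteq> carrier G" "\<one> \<in> U"
proof -
  show "U \<lhd> G" "openin T U"
    using assms by (auto simp: open_normal_def)
  then show "subgroup U G"
    by (simp add: normal_imp_subgroup)
  then show "U \<subseteq> carrier G" "\<one> \<in> U"
    by (auto intro: subgroup.subset[THEN subsetD] subgroup.one_closed)
qed

end

context profinite_group
begin

text \<open>In a compact Hausdorff space components and quasi-components agree, so the singleton
  component of \<open>\<one>\<close> can be separated from the compact complement of
  \<open>W\<close> by a clopen set.\<close>

lemma clopen_neighbourhood_one:
  assumes "openin T W" "\<one> \<in> W"
  shows "\<exists>V. openin T V \<and> closedin T V \<and> \<one> \<in> V \<and> V \<subseteq> W"
proof -
  let ?C = "connected_component_of_set T \<one>"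
  have top: "\<one> \<in> topspace T"
    by (simp add: topspace_eq_carrier)
  then have C: "?C \<in> connected_components_of T"
    by (simp add: connected_component_in_connected_components_of)
  then obtain x where "?C = {x}"
    using totally_disconnected by blast
  moreover have "\<one> \<in> ?C"
    using top by (simp add: connected_component_of_refl)
  ultimately have "?C = {\<one>}" by auto
  then have "{\<one>} \<in> connected_components_of T"
    using C by simp
  then have "{\<one>} \<in> quasi_components_of T"
    using compact_quasi_eq_connected_components_of[of T "{\<one>}"] compact Hausdorff top
    by (simp add: compact_imp_locally_compact_space)
  moreover have "compactin T (topspace T - W)"
    using assms(1) compact by (intro closedin_compact_space) auto
  moreover have "disjnt {\<one>} (topspace T - W)"
    using assms(2) by simp
  ultimately have "separated_between T {\<one>} (topspace T - W)"
    using separated_between_quasi_component_compact by blast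
  then obtain U V where "openin T U" "openin T V" "U \<union> V = topspace T" "disjnt U V" "\<one> \<in> U" "topspace T - W \<subseteq> V"
    unfolding separated_between_def by auto
  moreover from this have "U = topspace T - V"
    by (auto simp: disjnt_iff)
  ultimately show ?thesis
    by (intro exI[of _ U]) auto
qed

text \<open>For a clopen \<open>V\<close> containing \<open>\<one>\<close>, the elements \<open>x\<close> whose insertion in the middle of a product
  never changes membership in \<open>V\<close> form a normal subgroup inside \<open>V\<close>; it is open because its complement
  is a projection along the compact space of pairs \<open>(a, c)\<close>.\<close>

lemma open_normal_base:
  assumes "openin T W" "\<one> \<in> W"
  shows "\<exists>U. open_normal U \<and> U \<subseteq> W"
proof -
  obtain V where V: "openin T V" "closedin T V" "\<one> \<in> V" "V \<subseteq> W"
    using clopen_neighbourhood_one[OF assms] by blast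
  define U where "U = {x \<in> carrier G. \<forall>a\<in>carrier G. \<forall>c\<in>carrier G. a \<otimes> c \<in> V \<longleftrightarrow> a \<otimes> x \<otimes> c \<in> V}"
  have UD: "x \<in> carrier G" "a \<in> carrier G \<Longrightarrow> c \<in> carrier G \<Longrightarrow> a \<otimes> x \<otimes> c \<in> V \<longleftrightarrow> a \<otimes> c \<in> V"
    if "x \<in> U" for x a c
    using that by (auto simp: U_def)
  have "subgroup U G"
  proof
    show "U \<subseteq> carrier G" "\<one> \<in> U"
      by (auto simp: U_def)
    show "x \<otimes> y \<in> U" if x: "x \<in> U" and y: "y \<in> U" for x y
    proof -
      have "a \<otimes> (x \<otimes> y) \<otimes> c \<in> V \<longleftrightarrow> a \<otimes> c \<in> V" if "a \<in> carrier G" "c \<in> carrier G" for a c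
        using UD(2)[OF y, of "a \<otimes> x" c] UD(2)[OF x, of a c] UD(1)[OF x] UD(1)[OF y] that
        by (simp add: m_assoc)
      then show ?thesis
        using UD(1)[OF x] UD(1)[OF y] by (auto simp: U_def)
    qed
    show "inv x \<in> U" if x: "x \<in> U" for x
    proof -
      have "a \<otimes> inv x \<otimes> c \<in> V \<longleftrightarrow> a \<otimes> c \<in> V" if "a \<in> carrier G" "c \<in> carrier G" for a c
        using UD(2)[OF x, of "a \<otimes> inv x" c] UD(1)[OF x] that
        by (simp add: m_assoc)
      then show ?thesis
        using UD(1)[OF x] by (auto simp: U_def)
    qed
  qed
  moreover have "g \<otimes> x \<otimes> inv g \<in> U" if g: "g \<in> carrier G" and x: "x \<in> U" for g x
  proof -
    have "a \<otimes> (g \<otimes> x \<otimes> inv g) \<otimes> c \<in> V \<longleftrightarrow> a \<otimes> c \<in> V" if "a \<in> carrier G" "c \<in> carrier G" for a c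
      using UD(2)[OF x, of "a \<otimes> g" "inv g \<otimes> c"] UD(1)[OF x] that g
      by (simp add: m_assoc)
    then show ?thesis
      using UD(1)[OF x] g by (auto simp: U_def)
  qed
  ultimately have "U \<lhd> G"
    by (simp add: normal_inv_iff)
  moreover have "openin T U"
  proof -
    let ?P = "prod_topology (prod_topology T T) T"
    define f where "f p = fst (fst p) \<otimes> snd (fst p)" for p :: "('a \<times> 'a) \<times> 'a"
    define k where "k p = fst (fst p) \<otimes> snd p \<otimes> snd (fst p)" for p :: "('a \<times> 'a) \<times> 'a"
    have proj: "continuous_map ?P T (\<lambda>p. fst (fst p))" "continuous_map ?P T (\<lambda>p. snd (fst p))" "continuous_map ?P T (\<lambda>p. snd p)"
      using continuous_map_compose[OF continuous_map_fst[of "prod_topology T T" T] continuous_map_fst[of T T]]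
        continuous_map_compose[OF continuous_map_fst[of "prod_topology T T" T] continuous_map_snd[of T T]]
        continuous_map_snd[of "prod_topology T T" T]
      by (simp_all add: o_def)
    have cont: "continuous_map ?P T f" "continuous_map ?P T k"
      unfolding f_def k_def by (intro continuous_map_group_mult proj)+
    \<comment> \<open>\<open>D\<close> collects the \<open>((a, c), x)\<close> for which inserting
      \<open>x\<close> changes membership in \<open>V\<close>; it is closed because both
      \<open>V\<close> and its complement are.\<close>
    define D where "D = ({p \<in> topspace ?P. f p \<in> V} \<inter> {p \<in> topspace ?P. k p \<in> topspace T - V})
        \<union> ({p \<in> topspace ?P. k p \<in> V} \<inter> {p \<in> topspace ?P. f p \<in> topspace T - V})"
    have "closedin ?P D"
      unfolding D_def using V by (intro closedin_Un closedin_Int closedin_continuous_map_preimage[OF cont(1)] 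
          closedin_continuous_map_preimage[OF cont(2)]) auto
    moreover have "compact_space (prod_topology T T)"
      by (simp add: compact_space_prod_topology compact)
    ultimately have "closedin T (snd ` D)"
      using closed_map_snd[of "prod_topology T T" T] by (simp add: closed_map_def)
    moreover have "snd ` D = topspace T - U"
    proof
      show "snd ` D \<subseteq> topspace T - U"
        by (auto simp: D_def U_def f_def k_def topspace_eq_carrier)
      show "topspace T - U \<subseteq> snd ` D"
      proof
        fix x assume "x \<in> topspace T - U"
        then obtain a c where "x \<in> carrier G" "a \<in> carrier G" "c \<in> carrier G" "(a \<otimes> c \<in> V) \<noteq> (a \<otimes> x \<otimes> c \<in> V)"
          by (auto simp: U_def topspace_eq_carrier)
        then have "((a, c), x) \<in> D"
          by (auto simp: D_def f_def k_def topspace_eq_carrier)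
        then show "x \<in> snd ` D"
          by force
      qed
    qed
    moreover have "U \<subseteq> topspace T"
      by (auto simp: U_def topspace_eq_carrier)
    ultimately show ?thesis
      by (simp add: openin_closedin_eq)
  qed
  moreover have "U \<subseteq> V"
  proof
    fix x assume "x \<in> U"
    from UD(2)[OF this, of \<one> \<one>] UD(1)[OF this] V(3) show "x \<in> V"
      by simp
  qed
  ultimately show ?thesis
    using V by (intro exI[of _ U]) (auto simp: open_normal_def)
qed

text \<open>The cosets are an open partition, so a finite subcover already contains them
  all.\<close>

lemma finite_rcosets_open_normal:
  assumes "open_normal U"
  shows "finite ((\<lambda>x. U #> x) ` carrier G)"
proof -
  note U = open_normalD[OF assms]
  let ?C = "(\<lambda>x. U #> x) ` carrier G"
  have "\<forall>C\<in>?C. openin T C" "topspace T \<subseteq> \<Union>?C"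
    using U openin_rcos rcos_self[OF _ U(2)] by (auto simp: topspace_eq_carrier)
  with compact obtain F where F: "finite F" "F \<subseteq> ?C" "topspace T \<subseteq> \<Union>F"
    unfolding compact_space_alt by meson
  have "?C \<subseteq> F"
  proof
    fix C assume "C \<in> ?C"
    then obtain x where x: "x \<in> carrier G" "C = U #> x" by auto
    then obtain D where "D \<in> F" "x \<in> D"
      using F by (auto simp: topspace_eq_carrier)
    then obtain y where "y \<in> carrier G" "D = U #> y" "x \<in> U #> y"
      using F by auto
    then show "C \<in> F"
      using repr_independence[OF _ _ U(2), of x y] x \<open>D \<in> F\<close> by simp
  qed
  then show ?thesis
    using F(1) finite_subset by blast
qed

text \<open>Every neighbourhood of a point contains its coset modulo some open normal subgroup, so
  closure can be tested modulo each of these. Arguments about closed subgroups thereby become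
  computations in the quotients \<open>G Mod U\<close>.\<close>

lemma in_closure_iff:
  assumes "A \<subseteq> carrier G"
  shows "x \<in> T closure_of A \<longleftrightarrow> x \<in> carrier G \<and> (\<forall>U. open_normal U \<longrightarrow> (\<exists>a\<in>A. U #> a = U #> x))"
proof (intro iffI conjI allI impI)
  assume x: "x \<in> T closure_of A"
  then show xc: "x \<in> carrier G"
    by (simp add: in_closure_of topspace_eq_carrier)
  fix U assume "open_normal U"
  note U = open_normalD[OF this]
  have "openin T (U #> x)" "x \<in> U #> x"
    using U xc openin_rcos rcos_self by auto
  then obtain a where "a \<in> A" "a \<in> U #> x"
    using x by (auto simp: in_closure_of)
  then show "\<exists>a\<in>A. U #> a = U #> x"
    using repr_independence[OF _ xc U(2)] by metis
next
  assume x: "x \<in> carrier G \<and> (\<forall>U. open_normal U \<longrightarrow> (\<exists>a\<in>A. U #> a = U #> x))"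
  have "\<exists>y. y \<in> A \<and> y \<in> W" if W: "x \<in> W" "openin T W" for W
  proof -
    have "openin T {y \<in> carrier G. y \<otimes> x \<in> W}"
      using x W by (intro openin_vimage continuous_map_group) auto
    then obtain U where on: "open_normal U" and UW: "U \<subseteq> {y \<in> carrier G. y \<otimes> x \<in> W}"
      using open_normal_base[of "{y \<in> carrier G. y \<otimes> x \<in> W}"] x W by auto
    then obtain a where a: "a \<in> A" "U #> a = U #> x"
      using x by auto
    then have "a \<otimes> inv x \<in> U"
      using rcos_eq_iff[of U a x] open_normalD[OF on] x assms by auto
    then have "a \<otimes> inv x \<otimes> x \<in> W"
      using UW by auto
    then have "a \<in> W"
      using a assms x by (auto simp: m_assoc)
    then show ?thesis
      using a by auto
  qed
  then show "x \<in> T closure_of A"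
    using x by (auto simp: in_closure_of topspace_eq_carrier)
qed

lemma in_closedI:
  assumes "closedin T A" "x \<in> carrier G" "\<And>U. open_normal U \<Longrightarrow> \<exists>a\<in>A. U #> a = U #> x"
  shows "x \<in> A"
  using in_closure_iff[OF closedin_carrier[OF assms(1)], of x] assms closure_of_closedin[OF assms(1)] by simp

end

section \<open>Rank\<close>

text \<open>The least positive element of \<open>I\<close> works, by division with remainder; if
  there is none, \<open>I\<close> is zero and so is \<open>m\<close>. This serves for exponents in
  \<open>rank_le_procyclic\<close>.\<close>

lemma int_subgroup_cyclic:
  fixes I :: "int set"
  assumes "0 \<in> I" "\<And>a b. a \<in> I \<Longrightarrow> b \<in> I \<Longrightarrow> a - b \<in> I"
  shows "\<exists>m\<in>I. \<forall>k\<in>I. m dvd k"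
proof (cases "\<exists>n>0. int n \<in> I")
  case True
  define m where "m = (LEAST n. n > 0 \<and> int n \<in> I)"
  have m: "m > 0" "int m \<in> I"
    using LeastI_ex[OF True] by (auto simp: m_def)
  have least: "m \<le> n" if "n > 0" "int n \<in> I" for n
    unfolding m_def by (rule Least_le) (use that in simp)
  have mult: "int m * int j \<in> I" for j
  proof (induction j)
    case (Suc j)
    have "- int m \<in> I"
      using assms(2)[OF assms(1) m(2)] by simp
    from assms(2)[OF Suc this] show ?case
      by (simp add: algebra_simps)
  qed (simp add: assms)
  have mult': "int m * j \<in> I" for j
  proof (cases "j \<ge> 0")
    case True
    then show ?thesis using mult[of "nat j"] by simp
  next
    case False
    then show ?thesis using assms(2)[OF assms(1) mult[of "nat (-j)"]] by simp
  qed
  have "int m dvd k" if k: "k \<in> I" for k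
  proof -
    have "k - int m * (k div int m) \<in> I"
      by (rule assms(2)[OF k mult'])
    then have "int (nat (k mod int m)) \<in> I"
      using m by (simp add: minus_mult_div_eq_mod)
    moreover have "nat (k mod int m) < m"
      using m(1) by (simp add: nat_less_iff)
    ultimately have "nat (k mod int m) = 0"
      using least[of "nat (k mod int m)"] by (cases "nat (k mod int m) = 0") auto
    then show ?thesis
      using m pos_mod_sign[of "int m" k] by (intro dvd_eq_mod_eq_0[THEN iffD2]) linarith
  qed
  then show ?thesis
    using m by blast
next
  case False
  have "k = 0" if k: "k \<in> I" for k
  proof (rule ccontr)
    assume "k \<noteq> 0"
    moreover have "- k \<in> I"
      using assms(2)[OF assms(1) k] by simp
    ultimately show False
      using False k by (cases "k > 0") (metis zero_less_imp_eq_int of_nat_0_less_iff neg_0_less_iff_less not_less_iff_gr_or_eq)+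
  qed
  then show ?thesis
    using assms(1) by (intro bexI[of _ 0]) auto
qed

context profinite_group
begin

lemma open_normal_hom: "open_normal U \<Longrightarrow> group_hom G (G Mod U) (\<lambda>x. U #> x)"
  by (simp add: group_hom_rcos open_normalD)

lemma closed_subgroupD:
  assumes "closed_subgroup A G T"
  shows "subgroup A G" "closedin T A" "A \<subseteq> carrier G" "\<one> \<in> A"
    "x \<in> A \<Longrightarrow> y \<in> A \<Longrightarrow> x \<otimes> y \<in> A" "x \<in> A \<Longrightarrow> inv x \<in> A"
  using assms by (auto simp: closed_subgroup_def subgroup.one_closed subgroup.m_closed
      subgroup.m_inv_closed dest: subgroup.subset)

lemma closed_subgroup_Int:
  "closed_subgroup A G T \<Longrightarrow> closed_subgroup B G T \<Longrightarrow> closed_subgroup (A \<inter> B) G T"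
  by (simp add: closed_subgroup_def subgroups_Inter_pair closedin_Int)

lemma closed_subgroup_closure_of:
  assumes "subgroup A G"
  shows "closed_subgroup (T closure_of A) G T"
proof -
  interpret A: subgroup A G by fact
  note iff = in_closure_iff[OF A.subset]
  have "subgroup (T closure_of A) G"
  proof
    show "T closure_of A \<subseteq> carrier G" "\<one> \<in> T closure_of A"
      by (auto simp: iff)
    show "x \<otimes> y \<in> T closure_of A" if x: "x \<in> T closure_of A" and y: "y \<in> T closure_of A" for x y
      unfolding iff
    proof (intro conjI allI impI)
      show "x \<otimes> y \<in> carrier G"
        using x y by (simp add: iff)
      fix U assume U: "open_normal U"
      interpret h: group_hom G "G Mod U" "\<lambda>x. U #> x"
        by (rule open_normal_hom[OF U])
      obtain a b where "a \<in> A" "b \<in> A" "U #> a = U #> x" "U #> b = U #> y"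
        using x y U unfolding iff by metis
      then show "\<exists>a\<in>A. U #> a = U #> (x \<otimes> y)"
        using x y h.hom_mult[of a b] h.hom_mult[of x y] by (intro bexI[of _ "a \<otimes> b"]) (auto simp: iff)
    qed
    show "inv x \<in> T closure_of A" if x: "x \<in> T closure_of A" for x
      unfolding iff
    proof (intro conjI allI impI)
      show "inv x \<in> carrier G"
        using x by (simp add: iff)
      fix U assume U: "open_normal U"
      interpret h: group_hom G "G Mod U" "\<lambda>x. U #> x"
        by (rule open_normal_hom[OF U])
      obtain a where "a \<in> A" "U #> a = U #> x"
        using x U unfolding iff by metis
      then show "\<exists>a\<in>A. U #> a = U #> (inv x)"
        using x h.hom_inv[of a] h.hom_inv[of x] by (intro bexI[of _ "inv a"]) (auto simp: iff)
    qed
  qed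
  then show ?thesis
    by (simp add: closed_subgroup_def)
qed

lemma closed_subgroup_top_generate:
  "S \<subseteq> carrier G \<Longrightarrow> closed_subgroup (top_generate G T S) G T"
  by (simp add: top_generate_def closed_subgroup_closure_of generate_is_subgroup)

lemma generate_subset_top_generate:
  "S \<subseteq> carrier G \<Longrightarrow> generate G S \<subseteq> top_generate G T S"
  unfolding top_generate_def by (rule closure_of_subset) (simp add: topspace_eq_carrier generate_incl)

lemma subset_top_generate: "S \<subseteq> carrier G \<Longrightarrow> S \<subseteq> top_generate G T S"
  using generate_subset_top_generate generate.incl by (metis subset_iff)

lemma top_generate_minimal:
  assumes "closed_subgroup A G T" "S \<subseteq> A"
  shows "top_generate G T S \<subseteq> A"
  unfolding top_generate_def
  by (rule closure_of_minimal) (use assms generate_subgroup_incl closed_subgroupD in auto)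

lemma in_top_generate_iff:
  assumes "S \<subseteq> carrier G"
  shows "x \<in> top_generate G T S \<longleftrightarrow>
    x \<in> carrier G \<and> (\<forall>U. open_normal U \<longrightarrow> (\<exists>a\<in>generate G S. U #> a = U #> x))"
  unfolding top_generate_def by (rule in_closure_iff) (simp add: assms generate_incl)

lemma rcos_cong_mono:
  assumes "open_normal U" "open_normal V" "V \<subseteq> U" "x \<in> carrier G" "y \<in> carrier G" "V #> x = V #> y"
  shows "U #> x = U #> y"
  using assms rcos_eq_iff[of U x y] rcos_eq_iff[of V x y] open_normalD by blast

text \<open>Generating \<open>r\<close>-tuples exist by compactness of the space of tuples.\<close>

lemma top_generators_compact:
  assumes H: "closed_subgroup H G T"
    and gen: "\<And>U. open_normal U \<Longrightarrow>
      \<exists>X\<subseteq>H. finite X \<and> card X \<le> r \<and> (\<forall>y\<in>H. \<exists>a\<in>generate G X. U #> a = U #> y)"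
  shows "\<exists>X\<subseteq>H. finite X \<and> card X \<le> r \<and> top_generate G T X = H"
proof -
  note HD = closed_subgroupD[OF H]
  define P where "P = product_topology (\<lambda>_. T) (UNIV :: nat set)"
  have top: "topspace P = {x. \<forall>i. x i \<in> carrier G}"
    by (auto simp: P_def topspace_eq_carrier PiE_def Pi_def)
  have proj: "continuous_map P T (\<lambda>x. x i)" for i
    unfolding P_def by (rule continuous_map_product_projection) simp
  define E where "E U = {x. \<forall>y\<in>H. \<exists>a\<in>generate G (x ` {..<r}). U #> a = U #> y}" for U
  \<comment> \<open>A sequence lying in every \<open>F U\<close> generates \<open>H\<close>
    topologically with its first \<open>r\<close> entries, by \<open>in_top_generate_iff\<close>;
    the later entries are left free.\<close>
  define F where "F U = {x \<in> topspace P. (\<forall>i<r. x i \<in> H) \<and> x \<in> E U}" for U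
  have closed: "closedin P (F U)" if U: "open_normal U" for U
  proof -
    interpret h: group_hom G "G Mod U" "\<lambda>x. U #> x"
      by (rule open_normal_hom[OF U])
    note UD = open_normalD[OF U]
    \<comment> \<open>\<open>E U\<close> depends only on the cosets modulo \<open>U\<close> of the
      first \<open>r\<close> entries, so its complement contains an open box around each of its
      points.\<close>
    have Econg: "y \<in> E U" if xy: "x \<in> topspace P" "y \<in> topspace P" "\<And>i. i < r \<Longrightarrow> U #> x i = U #> y i"
      and x: "x \<in> E U" for x y
    proof -
      have gi: "(\<lambda>x. U #> x) ` generate G (z ` {..<r}) = generate (G Mod U) ((\<lambda>i. U #> z i) ` {..<r})"
        if "z \<in> topspace P" for z
        using h.generate_img[of "z ` {..<r}"] that by (auto simp: top image_image)
      have "(\<lambda>i. U #> x i) ` {..<r} = (\<lambda>i. U #> y i) ` {..<r}"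
        using xy(3) by (intro image_cong) auto
      then have eq: "(\<lambda>x. U #> x) ` generate G (x ` {..<r}) = (\<lambda>x. U #> x) ` generate G (y ` {..<r})"
        using gi xy by simp
      have E_alt: "z \<in> E U \<longleftrightarrow> (\<lambda>x. U #> x) ` H \<subseteq> (\<lambda>x. U #> x) ` generate G (z ` {..<r})" for z
        unfolding E_def mem_Collect_eq image_subset_iff image_iff by metis
      show ?thesis
        using x eq by (simp add: E_alt)
    qed
    have "openin P (topspace P - F U)"
    proof (subst openin_subopen, intro ballI)
      fix x assume x: "x \<in> topspace P - F U"
      consider i where "i < r" "x i \<notin> H" | "x \<notin> E U"
        using x by (auto simp: F_def)
      then show "\<exists>W. openin P W \<and> x \<in> W \<and> W \<subseteq> topspace P - F U"
      proof cases
        case 1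
        have "openin P {z \<in> topspace P. z i \<in> carrier G - H}"
          using HD(2) topspace_eq_carrier
          by (intro openin_continuous_map_preimage[OF proj]) (auto simp: closedin_def)
        then show ?thesis
          using 1 x by (intro exI conjI) (auto simp: top F_def)
      next
        case 2
        define S where "S i = (if i < r then U #> x i else carrier G)" for i
        have "openin P (PiE UNIV S)"
        proof -
          have "finite {i. S i \<noteq> carrier G}"
            by (rule finite_subset[of _ "{..<r}"]) (auto simp: S_def)
          moreover have "openin T (S i)" for i
            using openin_rcos[OF UD(2,3)] x openin_carrier by (auto simp: S_def top)
          ultimately show ?thesis
            by (simp add: P_def openin_PiE_gen topspace_eq_carrier)
        qed
        moreover have "x \<in> PiE UNIV S"
          using x rcos_self[OF _ UD(2)] by (auto simp: S_def top)
        moreover have "PiE UNIV S \<subseteq> topspace P - F U"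
        proof
          fix z assume z: "z \<in> PiE UNIV S"
          then have zc: "z \<in> topspace P"
            using openin_subset[OF \<open>openin P (PiE UNIV S)\<close>] by blast
          have "z i \<in> U #> x i" if "i < r" for i
            using z that by (auto simp: S_def PiE_def Pi_def split: if_splits)
          then have "U #> z i = U #> x i" if "i < r" for i
            using repr_independence[OF _ _ UD(2)] that x by (metis DiffD1 mem_Collect_eq top)
          then have "z \<notin> E U"
            using Econg[of z x] zc x 2 by blast
          then show "z \<in> topspace P - F U"
            using zc by (simp add: F_def)
        qed
        ultimately show ?thesis by blast
      qed
    qed
    moreover have "F U \<subseteq> topspace P"
      by (auto simp: F_def)
    ultimately show ?thesis
      by (simp add: closedin_def)
  qed
  have ne: "F U \<noteq> {}" if U: "open_normal U" for U
  proof -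
    obtain X where X: "X \<subseteq> H" "finite X" "card X \<le> r" "\<forall>y\<in>H. \<exists>a\<in>generate G X. U #> a = U #> y"
      using gen[OF U] by blast
    obtain f where f: "bij_betw f {0..<card X} X"
      using ex_bij_betw_nat_finite[OF X(2)] by blast
    \<comment> \<open>Fewer than \<open>r\<close> generators are padded with
      \<open>\<one>\<close>.\<close>
    define x where "x i = (if i < card X then f i else \<one>)" for i
    have xH: "x i \<in> H" for i
      using X(1) f HD(4) by (auto simp: x_def bij_betw_def)
    have "X \<subseteq> x ` {..<r}"
    proof
      fix y assume "y \<in> X"
      then have "y \<in> f ` {0..<card X}"
        using f by (simp add: bij_betw_def)
      then obtain i where "i < card X" "y = f i"
        by auto
      then show "y \<in> x ` {..<r}"
        using X(3) by (intro image_eqI[of _ _ i]) (auto simp: x_def)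
    qed
    then have "x \<in> E U"
      using X(4) mono_generate[of X "x ` {..<r}"] unfolding E_def mem_Collect_eq by (meson subsetD)
    then have "x \<in> F U"
      using xH HD(3) by (auto simp: F_def top)
    then show ?thesis by blast
  qed
  have mono: "F V \<subseteq> F U" if "open_normal U" "open_normal V" "V \<subseteq> U" for U V
  proof
    fix x assume x: "x \<in> F V"
    have "x ` {..<r} \<subseteq> carrier G"
      using x by (auto simp: F_def top)
    then have "generate G (x ` {..<r}) \<subseteq> carrier G"
      by (rule generate_incl)
    then have "x \<in> E U"
      using x rcos_cong_mono[OF that] HD(3) unfolding F_def E_def by blast
    then show "x \<in> F U"
      using x by (simp add: F_def)
  qed
  have "compact_space P"
    by (simp add: P_def compact_space_product_topology compact)
  moreover have "\<forall>C\<in>F ` Collect open_normal. closedin P C"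
    using closed by blast
  \<comment> \<open>\<open>F\<close> is monotone in \<open>U\<close>, so finitely many sets
    \<open>F U\<close> all contain \<open>F V\<close> for a common \<open>V\<close>.\<close>
  moreover have "\<Inter>\<F> \<noteq> {}" if "finite \<F>" "\<F> \<subseteq> F ` Collect open_normal" for \<F>
  proof -
    obtain \<U> where U: "\<U> \<subseteq> Collect open_normal" "finite \<U>" "\<F> = F ` \<U>"
      using finite_subset_image[of \<F> F "Collect open_normal"] \<open>finite \<F>\<close> \<open>\<F> \<subseteq> _\<close> by blast
    then obtain V where V: "open_normal V" "\<forall>U\<in>\<U>. V \<subseteq> U"
      using open_normal_INT[of \<U> "\<lambda>U. U"] by auto
    then have "F V \<subseteq> \<Inter>\<F>"
      using mono U by blast
    then show ?thesis
      using ne[OF V(1)] by blast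
  qed
  ultimately have "\<Inter>(F ` Collect open_normal) \<noteq> {}"
    unfolding compact_space_fip by blast
  then obtain x where x: "\<And>U. open_normal U \<Longrightarrow> x \<in> F U"
    by blast
  define X where "X = x ` {..<r}"
  have XH: "X \<subseteq> H"
    using x[OF open_normal_carrier] by (auto simp: X_def F_def)
  have "H \<subseteq> top_generate G T X"
  proof
    fix y assume y: "y \<in> H"
    then show "y \<in> top_generate G T X"
      using x XH HD(3) by (subst in_top_generate_iff) (auto simp: F_def E_def X_def)
  qed
  then have "top_generate G T X = H"
    using top_generate_minimal[OF H XH] by blast
  moreover have "card X \<le> r"
    using card_image_le[of "{..<r}" x] by (simp add: X_def)
  ultimately show ?thesis
    using XH by (intro exI[of _ X]) (auto simp: X_def)
qed

end

text \<open>All closed subgroups of \<open>A\<close> are bounded here, not only the finitely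
  generated ones, and everything is stated inside \<open>G\<close>. This makes passage to closed
  subgroups immediate; \<open>subgroup_finite_rank_iff\<close> shows that the resulting notion of
  finite rank is the same.\<close>

definition (in topological_group) rank_le :: "'a set \<Rightarrow> nat \<Rightarrow> bool" where
  "rank_le A r \<longleftrightarrow> closed_subgroup A G T \<and> (\<forall>B. closed_subgroup B G T \<and> B \<subseteq> A \<longrightarrow>
     (\<exists>X\<subseteq>B. finite X \<and> card X \<le> r \<and> top_generate G T X = B))"

section \<open>Closed subgroups of finite rank\<close>

context profinite_group
begin

lemma rank_leE:
  assumes "rank_le A r" "closed_subgroup B G T" "B \<subseteq> A"
  obtains X where "X \<subseteq> B" "finite X" "card X \<le> r" "top_generate G T X = B"
  using assms unfolding rank_le_def by blast

lemma rank_le_mono: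
  "rank_le A r \<Longrightarrow> closed_subgroup B G T \<Longrightarrow> B \<subseteq> A \<Longrightarrow> rank_le B r"
  unfolding rank_le_def by blast

text \<open>The step from finitely generated to arbitrary closed subgroups \<open>B\<close> goes
  through finite quotients: modulo an open normal \<open>U\<close>, \<open>B\<close> agrees with a
  finitely generated closed subgroup of itself, which has at most \<open>r\<close> generators, and
  \<open>top_generators_compact\<close> assembles these. Generation inside \<open>A\<close> and
  inside \<open>G\<close> coincide because \<open>A\<close> is closed.\<close>

lemma subgroup_finite_rank_iff:
  assumes A: "closed_subgroup A G T"
  shows "subgroup_finite_rank A G T \<longleftrightarrow> (\<exists>r. rank_le A r)"
proof -
  note AD = closed_subgroupD[OF A]
  let ?G = "G\<lparr>carrier := A\<rparr>" and ?T = "subtopology T A"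
  have gen: "top_generate ?G ?T S = top_generate G T S" if S: "S \<subseteq> A" for S
  proof -
    have "generate G S \<subseteq> A"
      by (rule generate_subgroup_incl[OF S AD(1)])
    then have "top_generate ?G ?T S = A \<inter> top_generate G T S"
      using generate_consistent[OF S AD(1)]
      by (simp add: top_generate_def closure_of_subtopology inf_absorb2)
    then show ?thesis
      using top_generate_minimal[OF A S] by blast
  qed
  have sub: "closed_subgroup B ?G ?T \<longleftrightarrow> closed_subgroup B G T \<and> B \<subseteq> A" for B
    using AD incl_subgroup[OF AD(1), of B] subgroup_incl[OF _ AD(1), of B] 
      closedin_closed_subtopology[OF AD(2), of B] by (auto simp: closed_subgroup_def)
  have "rank_at_most ?G ?T r \<longleftrightarrow> rank_le A r" for r
  proof
    assume r: "rank_at_most ?G ?T r"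
    have "\<exists>X\<subseteq>B. finite X \<and> card X \<le> r \<and> top_generate G T X = B"
      if B: "closed_subgroup B G T" "B \<subseteq> A" for B
    proof (rule top_generators_compact[OF B(1)])
      fix U assume U: "open_normal U"
      note BD = closed_subgroupD[OF B(1)]
      have "finite ((\<lambda>x. U #> x) ` B)"
        by (rule finite_subset[OF image_mono[OF BD(3)] finite_rcosets_open_normal[OF U]])
      then obtain S where S: "S \<subseteq> B" "finite S" "(\<lambda>x. U #> x) ` B = (\<lambda>x. U #> x) ` S"
        using finite_subset_image[of "(\<lambda>x. U #> x) ` B" "\<lambda>x. U #> x" B] by blast
      have SG: "S \<subseteq> carrier G" "S \<subseteq> A"
        using S B BD by auto
      have "closed_subgroup (top_generate G T S) ?G ?T"
        using sub closed_subgroup_top_generate[OF SG(1)] top_generate_minimal[OF A SG(2)] by blast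
      moreover have "S \<subseteq> carrier ?G \<and> finite S \<and> top_generate ?G ?T S = top_generate G T S"
        using S SG gen by simp
      ultimately have "\<exists>X. X \<subseteq> carrier ?G \<and> finite X \<and> card X \<le> r \<and> top_generate ?G ?T X = top_generate G T S"
        using r unfolding rank_at_most_def by blast
      then obtain X where X: "X \<subseteq> A" "finite X" "card X \<le> r" "top_generate ?G ?T X = top_generate G T S"
        by auto
      have eq: "top_generate G T X = top_generate G T S"
        using X gen by simp
      have XG: "X \<subseteq> carrier G"
        using X AD by auto
      have "X \<subseteq> top_generate G T S"
        using eq subset_top_generate[OF XG] by simp
      also have "\<dots> \<subseteq> B"
        by (rule top_generate_minimal[OF B(1) S(1)])
      finally have "X \<subseteq> B" .
      moreover have "\<exists>a\<in>generate G X. U #> a = U #> y" if y: "y \<in> B" for y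
      proof -
        obtain s where s: "s \<in> S" "U #> s = U #> y"
          using S(3) y by (metis imageE imageI)
        then have "s \<in> top_generate G T X"
          using eq subset_top_generate[OF SG(1)] by auto
        then show ?thesis
          using in_top_generate_iff[OF XG, of s] U s by metis
      qed
      ultimately show "\<exists>X\<subseteq>B. finite X \<and> card X \<le> r \<and> (\<forall>y\<in>B. \<exists>a\<in>generate G X. U #> a = U #> y)"
        using X by blast
    qed
    then show "rank_le A r"
      using A by (simp add: rank_le_def)
  next
    assume r: "rank_le A r"
    show "rank_at_most ?G ?T r"
      unfolding rank_at_most_def
    proof (intro allI impI)
      fix B assume "closed_subgroup B ?G ?T \<and> (\<exists>S. S \<subseteq> carrier ?G \<and> finite S \<and> top_generate ?G ?T S = B)"
      then have B: "closed_subgroup B G T" "B \<subseteq> A"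
        using sub by auto
      obtain X where "X \<subseteq> B" "finite X" "card X \<le> r" "top_generate G T X = B"
        using rank_leE[OF r B] .
      then show "\<exists>S. S \<subseteq> carrier ?G \<and> finite S \<and> card S \<le> r \<and> top_generate ?G ?T S = B"
        using B gen by (intro exI[of _ X]) auto
    qed
  qed
  then show ?thesis
    by (simp add: subgroup_finite_rank_def finite_rank_def)
qed

lemma rank_le_trivial: "rank_le {\<one>} 0"
proof -
  have cl: "closedin T {\<one>}"
    using Hausdorff by (simp add: closedin_Hausdorff_sing_eq topspace_eq_carrier)
  then have "closed_subgroup {\<one>} G T"
    by (simp add: closed_subgroup_def triv_subgroup)
  moreover have "top_generate G T {} = {\<one>}"
    using closure_of_closedin[OF cl] by (simp add: top_generate_def generate_empty)
  moreover have "B = {\<one>}" if "closed_subgroup B G T" "B \<subseteq> {\<one>}" for B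
    using closed_subgroupD[OF that(1)] that by auto
  ultimately show ?thesis
    unfolding rank_le_def by (metis card.empty empty_subsetI finite.emptyI order_refl)
qed

lemma closedin_set_mult:
  assumes "closedin T A" "closedin T B"
  shows "closedin T (A <#> B)"
proof -
  have "compactin (prod_topology T T) (A \<times> B)"
    using assms compact by (simp add: compactin_Times closedin_compact_space)
  then have "compactin T ((\<lambda>(x, y). x \<otimes> y) ` (A \<times> B))"
    by (rule image_compactin[OF _ continuous_mult])
  moreover have "(\<lambda>(x, y). x \<otimes> y) ` (A \<times> B) = A <#> B"
    by (auto simp: set_mult_def)
  ultimately show ?thesis
    using compactin_imp_closedin Hausdorff by simp
qed

lemma set_multE:
  assumes "x \<in> A <#> B"
  obtains a b where "a \<in> A" "b \<in> B" "x = a \<otimes> b"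
  using assms by (auto simp: set_mult_def)

lemma set_multI: "a \<in> A \<Longrightarrow> b \<in> B \<Longrightarrow> a \<otimes> b \<in> A <#> B"
  by (auto simp: set_mult_def)

lemma closed_subgroup_set_mult:
  assumes K: "closed_subgroup K G T" and N: "closed_subgroup N G T"
    and norm: "\<And>k n. k \<in> K \<Longrightarrow> n \<in> N \<Longrightarrow> k \<otimes> n \<otimes> inv k \<in> N"
  shows "closed_subgroup (K <#> N) G T"
proof -
  note KD = closed_subgroupD[OF K] and ND = closed_subgroupD[OF N]
  have norm': "inv k \<otimes> n \<otimes> k \<in> N" if "k \<in> K" "n \<in> N" for k n
    using norm[of "inv k" n] that KD by auto
  have c: "k \<in> K \<Longrightarrow> k \<in> carrier G" "n \<in> N \<Longrightarrow> n \<in> carrier G" for k n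
    using KD ND by auto
  have "subgroup (K <#> N) G"
  proof
    show "K <#> N \<subseteq> carrier G"
      using KD ND by (simp add: setmult_subset_G)
    show "\<one> \<in> K <#> N"
      using set_multI[OF KD(4) ND(4)] by simp
    show "x \<otimes> y \<in> K <#> N" if x: "x \<in> K <#> N" and y: "y \<in> K <#> N" for x y
    proof -
      from x obtain k n where 1: "k \<in> K" "n \<in> N" "x = k \<otimes> n" by (rule set_multE)
      from y obtain l m where 2: "l \<in> K" "m \<in> N" "y = l \<otimes> m" by (rule set_multE)
      have "x \<otimes> y = (k \<otimes> l) \<otimes> ((inv l \<otimes> n \<otimes> l) \<otimes> m)"
        using 1 2 c by (simp add: m_assoc)
      then show ?thesis
        using 1 2 norm' KD(5) ND(5) by (auto intro: set_multI)
    qed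
    show "inv x \<in> K <#> N" if x: "x \<in> K <#> N" for x
    proof -
      from x obtain k n where 1: "k \<in> K" "n \<in> N" "x = k \<otimes> n" by (rule set_multE)
      have "inv x = inv k \<otimes> (k \<otimes> inv n \<otimes> inv k)"
        using 1 c by (simp add: m_assoc inv_mult_group)
      then show ?thesis
        using 1 norm KD(6) ND(6) by (auto intro: set_multI)
    qed
  qed
  then show ?thesis
    using closedin_set_mult KD ND by (simp add: closed_subgroup_def)
qed

lemma subset_set_mult:
  assumes "closed_subgroup K G T" "closed_subgroup N G T"
  shows "K \<subseteq> K <#> N" "N \<subseteq> K <#> N"
proof -
  note KD = closed_subgroupD[OF assms(1)] and ND = closed_subgroupD[OF assms(2)]
  show "K \<subseteq> K <#> N"
    using set_multI[OF _ ND(4), of _ K] KD(3) by force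
  show "N \<subseteq> K <#> N"
    using set_multI[OF KD(4), of _ N] ND(3) by force
qed

text \<open>An extension argument without forming a quotient: generators of \<open>B\<close> modulo
  \<open>N\<close> are found in \<open>K\<close>, through \<open>K \<inter> (B <#> N)\<close>, and
  lifted to \<open>B\<close>; generators of \<open>B \<inter> N\<close> supply the rest.\<close>

lemma rank_le_set_mult:
  assumes K: "rank_le K r" and N: "rank_le N s"
    and norm: "\<And>k n. k \<in> K \<Longrightarrow> n \<in> N \<Longrightarrow> k \<otimes> n \<otimes> inv k \<in> N"
  shows "rank_le (K <#> N) (r + s)"
proof -
  have Kc: "closed_subgroup K G T" and Nc: "closed_subgroup N G T"
    using K N by (auto simp: rank_le_def)
  note KD = closed_subgroupD[OF Kc] and ND = closed_subgroupD[OF Nc]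
  have "\<exists>X\<subseteq>B. finite X \<and> card X \<le> r + s \<and> top_generate G T X = B"
    if B: "closed_subgroup B G T" "B \<subseteq> K <#> N" for B
  proof -
    note BD = closed_subgroupD[OF B(1)]
    have c: "k \<in> K \<Longrightarrow> k \<in> carrier G" "n \<in> N \<Longrightarrow> n \<in> carrier G" "b \<in> B \<Longrightarrow> b \<in> carrier G" for k n b
      using KD ND BD by auto
    have normB: "b \<otimes> n \<otimes> inv b \<in> N" if b: "b \<in> B" and n: "n \<in> N" for b n
    proof -
      from subsetD[OF B(2) b] obtain k m where km: "k \<in> K" "m \<in> N" "b = k \<otimes> m"
        by (rule set_multE)
      then have "b \<otimes> n \<otimes> inv b = k \<otimes> (m \<otimes> n \<otimes> inv m) \<otimes> inv k"
        using n c by (simp add: m_assoc inv_mult_group)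
      then show ?thesis
        using norm km n ND(5,6) by simp
    qed
    define D where "D = K \<inter> (B <#> N)"
    have "closed_subgroup (B <#> N) G T"
      by (rule closed_subgroup_set_mult[OF B(1) Nc normB])
    then have D: "closed_subgroup D G T" "D \<subseteq> K"
      using closed_subgroup_Int Kc by (auto simp: D_def)
    obtain X where X: "X \<subseteq> D" "finite X" "card X \<le> r" "top_generate G T X = D"
      using rank_leE[OF K D] .
    have "closed_subgroup (B \<inter> N) G T"
      by (rule closed_subgroup_Int[OF B(1) Nc])
    then obtain Z where Z: "Z \<subseteq> B \<inter> N" "finite Z" "card Z \<le> s" "top_generate G T Z = B \<inter> N"
      using rank_leE[OF N, of "B \<inter> N"] by auto
    have "\<forall>x\<in>X. \<exists>b\<in>B. \<exists>n\<in>N. x = b \<otimes> n"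
      using X(1) unfolding D_def by (meson IntD2 set_multE subsetD)
    then obtain \<beta> where \<beta>: "\<And>x. x \<in> X \<Longrightarrow> \<beta> x \<in> B \<and> (\<exists>n\<in>N. x = \<beta> x \<otimes> n)"
      by metis
    define Y where "Y = \<beta> ` X \<union> Z"
    have YB: "Y \<subseteq> B"
      using \<beta> Z by (auto simp: Y_def)
    define C where "C = top_generate G T Y"
    have YG: "Y \<subseteq> carrier G"
      using YB BD by auto
    have C: "closed_subgroup C G T" "C \<subseteq> B" "Y \<subseteq> C"
      using YG YB B(1) subset_top_generate closed_subgroup_top_generate top_generate_minimal by (auto simp: C_def)
    note CD = closed_subgroupD[OF C(1)]
    have CN: "closed_subgroup (C <#> N) G T"
      by (rule closed_subgroup_set_mult[OF C(1) Nc]) (use C(2) normB in auto)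
    have "X \<subseteq> C <#> N"
    proof
      fix x assume x: "x \<in> X"
      then obtain n where "n \<in> N" "x = \<beta> x \<otimes> n"
        using \<beta> by blast
      moreover have "\<beta> x \<in> C"
        using C(3) x by (auto simp: Y_def)
      ultimately show "x \<in> C <#> N"
        using set_multI[of "\<beta> x" C n N] by simp
    qed
    then have DC: "D \<subseteq> C <#> N"
      using top_generate_minimal[OF CN] X by blast
    have ZC: "B \<inter> N \<subseteq> C"
      using top_generate_minimal[OF C(1), of Z] C(3) Z by (auto simp: Y_def)
    have "B \<subseteq> C"
    proof
      fix b assume b: "b \<in> B"
      from subsetD[OF B(2) b] obtain k n where kn: "k \<in> K" "n \<in> N" "b = k \<otimes> n"
        by (rule set_multE)
      then have "k = b \<otimes> inv n"
        using c by (simp add: m_assoc)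
      then have "k \<in> D"
        using kn b ND(6) set_multI[of b B "inv n" N] by (simp add: D_def)
      from subsetD[OF DC this] obtain d m where dm: "d \<in> C" "m \<in> N" "k = d \<otimes> m"
        by (rule set_multE)
      have dB: "d \<in> B"
        using dm C(2) by auto
      have b_eq: "b = d \<otimes> (m \<otimes> n)"
        using kn dm dB c by (simp add: m_assoc)
      then have "m \<otimes> n = inv d \<otimes> b"
        using dm kn dB c by simp
      then have "m \<otimes> n \<in> B \<inter> N"
        using BD(5)[OF BD(6)[OF dB] b] ND(5)[OF dm(2) kn(2)] by simp
      then show "b \<in> C"
        using b_eq ZC CD(5) dm by auto
    qed
    then have "top_generate G T Y = B"
      using C by (auto simp: C_def)
    moreover have "card Y \<le> r + s"
      using card_Un_le[of "\<beta> ` X" Z] card_image_le[OF X(2), of \<beta>] X(3) Z(3) by (simp add: Y_def)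
    ultimately show ?thesis
      using YB X Z by (intro exI[of _ Y]) (auto simp: Y_def)
  qed
  then show ?thesis
    using closed_subgroup_set_mult[OF Kc Nc norm] by (simp add: rank_le_def)
qed

text \<open>A closed subgroup \<open>B\<close> of \<open>A\<close> is generated by
  \<open>B \<inter> Y\<close> together with one element of \<open>B\<close> from each coset of
  \<open>Y\<close> that it meets, whence the summand \<open>card S\<close>.\<close>

lemma rank_le_finite_cover:
  assumes Y: "rank_le Y r" and A: "closed_subgroup A G T" and S: "finite S" "S \<subseteq> carrier G"
    and cover: "A \<subseteq> S <#> Y"
  shows "rank_le A (r + card S)"
proof -
  have Yc: "closed_subgroup Y G T"
    using Y by (auto simp: rank_le_def)
  note YD = closed_subgroupD[OF Yc]
  have "\<exists>X\<subseteq>B. finite X \<and> card X \<le> r + card S \<and> top_generate G T X = B"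
    if B: "closed_subgroup B G T" "B \<subseteq> A" for B
  proof -
    note BD = closed_subgroupD[OF B(1)]
    have BY: "closed_subgroup (B \<inter> Y) G T"
      by (rule closed_subgroup_Int[OF B(1) Yc])
    obtain X where X: "X \<subseteq> B \<inter> Y" "finite X" "card X \<le> r" "top_generate G T X = B \<inter> Y"
      using rank_leE[OF Y BY] by auto
    \<comment> \<open>Cosets missing \<open>B\<close> get the harmless value \<open>\<one>\<close>,
      so that \<open>\<beta> s\<close> always lies in \<open>B\<close>.\<close>
    define \<beta> where "\<beta> s = (if \<exists>b\<in>B. \<exists>y\<in>Y. b = s \<otimes> y then SOME b. b \<in> B \<and> (\<exists>y\<in>Y. b = s \<otimes> y) else \<one>)" for s
    have \<beta>: "\<beta> s \<in> B \<and> (\<exists>y\<in>Y. \<beta> s = s \<otimes> y)" if "b \<in> B" "y \<in> Y" "b = s \<otimes> y" for s b y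
    proof -
      have ex: "\<exists>b. b \<in> B \<and> (\<exists>y\<in>Y. b = s \<otimes> y)"
        using that by blast
      then have "\<beta> s = (SOME b. b \<in> B \<and> (\<exists>y\<in>Y. b = s \<otimes> y))"
        by (auto simp: \<beta>_def)
      then show ?thesis
        using someI_ex[OF ex] by simp
    qed
    have \<beta>B: "\<beta> s \<in> B" for s
      using \<beta>[of _ _ s] BD(4) by (cases "\<exists>b\<in>B. \<exists>y\<in>Y. b = s \<otimes> y") (auto simp: \<beta>_def)
    define W where "W = \<beta> ` S \<union> X"
    have WB: "W \<subseteq> B"
      using \<beta>B X by (auto simp: W_def)
    then have WG: "W \<subseteq> carrier G"
      using BD by auto
    have C: "closed_subgroup (top_generate G T W) G T"
      by (rule closed_subgroup_top_generate[OF WG])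
    note CD = closed_subgroupD[OF C]
    have BYC: "B \<inter> Y \<subseteq> top_generate G T W"
      using top_generate_minimal[OF C, of X] subset_top_generate[OF WG] X by (auto simp: W_def)
    have "B \<subseteq> top_generate G T W"
    proof
      fix b assume b: "b \<in> B"
      then obtain s y where sy: "s \<in> S" "y \<in> Y" "b = s \<otimes> y"
        using B(2) cover by (metis set_multE subsetD)
      obtain y' where y': "y' \<in> Y" "\<beta> s = s \<otimes> y'"
        using \<beta>[OF b sy(2,3)] by auto
      have c: "s \<in> carrier G" "y \<in> carrier G" "y' \<in> carrier G" "\<beta> s \<in> carrier G" "b \<in> carrier G"
        using sy y' S YD(3) \<beta>B[of s] BD(3) b by auto
      have "inv (\<beta> s) \<otimes> b = inv y' \<otimes> y"
        unfolding y'(2) sy(3) using c by (simp add: m_assoc inv_mult_group)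
      then have "inv (\<beta> s) \<otimes> b \<in> B \<inter> Y"
        using BD(5)[OF BD(6)[OF \<beta>B] b, of s] YD(5)[OF YD(6)[OF y'(1)] sy(2)] by simp
      then have "\<beta> s \<otimes> (inv (\<beta> s) \<otimes> b) \<in> top_generate G T W"
        using CD(5)[of "\<beta> s"] BYC subset_top_generate[OF WG] sy(1) by (auto simp: W_def)
      then show "b \<in> top_generate G T W"
        using c by simp
    qed
    then have "top_generate G T W = B"
      using top_generate_minimal[OF B(1) WB] by auto
    moreover have "card W \<le> r + card S"
      using card_Un_le[of "\<beta> ` S" X] card_image_le[OF S(1), of \<beta>] X(3) by (simp add: W_def)
    ultimately show ?thesis
      using WB X S by (intro exI[of _ W]) (auto simp: W_def)
  qed
  then show ?thesis
    using A by (simp add: rank_le_def)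
qed

text \<open>Modulo an open normal subgroup \<open>U\<close>, the exponents \<open>k\<close> for
  which \<open>z [^] k\<close> is congruent to an element of \<open>B\<close> form a subgroup of the
  integers. Its generator gives one generator of \<open>B\<close> modulo \<open>U\<close>, and
  compactness does the rest.\<close>

lemma rank_le_procyclic:
  assumes z: "z \<in> carrier G"
  shows "rank_le (top_generate G T {z}) 1"
proof -
  have zG: "{z} \<subseteq> carrier G"
    using z by simp
  have "\<exists>X\<subseteq>B. finite X \<and> card X \<le> 1 \<and> top_generate G T X = B"
    if B: "closed_subgroup B G T" "B \<subseteq> top_generate G T {z}" for B
  proof (rule top_generators_compact[OF B(1)])
    note BD = closed_subgroupD[OF B(1)]
    fix U assume U: "open_normal U"
    interpret h: group_hom G "G Mod U" "\<lambda>x. U #> x"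
      by (rule open_normal_hom[OF U])
    define I where "I = {k :: int. \<exists>b\<in>B. U #> b = U #> (z [^] k)}"
    have "0 \<in> I"
      using BD(4) by (auto simp: I_def intro!: bexI[of _ \<one>])
    moreover have "k - l \<in> I" if kl: "k \<in> I" "l \<in> I" for k l
    proof -
      obtain b c where bc: "b \<in> B" "c \<in> B" "U #> b = U #> (z [^] k)" "U #> c = U #> (z [^] l)"
        using kl by (auto simp: I_def)
      then have "b \<in> carrier G" "c \<in> carrier G"
        using BD by auto
      then have "U #> (b \<otimes> inv c) = U #> (z [^] (k - l))"
        using bc z h.hom_mult[of b "inv c"] h.hom_mult[of "z [^] k" "inv (z [^] l)"] h.hom_inv[of c] h.hom_inv[of "z [^] l"]
        by (simp add: int_pow_diff)
      then show ?thesis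
        using bc BD(5,6) by (auto simp: I_def)
    qed
    ultimately obtain m where m: "m \<in> I" "\<And>k. k \<in> I \<Longrightarrow> m dvd k"
      using int_subgroup_cyclic[of I] by blast
    obtain x where x: "x \<in> B" "U #> x = U #> (z [^] m)"
      using m(1) by (auto simp: I_def)
    have xG: "x \<in> carrier G"
      using x BD by auto
    have "\<exists>a\<in>generate G {x}. U #> a = U #> y" if y: "y \<in> B" for y
    proof -
      obtain a where "a \<in> generate G {z}" "U #> a = U #> y"
        using y B(2) in_top_generate_iff[OF zG] U by blast
      then obtain k :: int where k: "U #> (z [^] k) = U #> y"
        using generate_pow[OF z] by auto
      then have "k \<in> I"
        using y by (auto simp: I_def)
      then obtain j where j: "k = m * j"
        using m(2) by (auto simp: dvd_def)
      have "U #> (x [^] j) = U #> ((z [^] m) [^] j)"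
        using h.hom_int_pow[OF xG, of j] h.hom_int_pow[of "z [^] m" j] x z by simp
      also have "(z [^] m) [^] j = z [^] k"
        using z j by (simp add: int_pow_pow)
      finally show ?thesis
        using k generate_pow[OF xG] by auto
    qed
    then show "\<exists>X\<subseteq>B. finite X \<and> card X \<le> 1 \<and> (\<forall>y\<in>B. \<exists>a\<in>generate G X. U #> a = U #> y)"
      using x by (intro exI[of _ "{x}"]) auto
  qed
  then show ?thesis
    using closed_subgroup_top_generate[OF zG] by (simp add: rank_le_def)
qed

end

section \<open>Words covered by finitely many subgroups\<close>

text \<open>A finite substitute for Baire's theorem: either \<open>W\<close> lies in
  \<open>C a\<close>, or removing the closed set \<open>C a\<close> leaves a nonempty open set
  covered by the others.\<close>

lemma open_finite_closed_cover:
  assumes "finite A" "openin X W" "W \<noteq> {}" "\<And>a. a \<in> A \<Longrightarrow> closedin X (C a)" "W \<subseteq> (\<Union>a\<in>A. C a)"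
  shows "\<exists>a\<in>A. \<exists>W'. openin X W' \<and> W' \<noteq> {} \<and> W' \<subseteq> W \<and> W' \<subseteq> C a"
  using assms
proof (induction A arbitrary: W rule: finite_induct)
  case (insert a A)
  show ?case
  proof (cases "W \<subseteq> C a")
    case True
    then show ?thesis
      using insert.prems by blast
  next
    case False
    have "openin X (W - C a)"
      using insert.prems by (intro openin_diff) auto
    moreover have "W - C a \<noteq> {}" "W - C a \<subseteq> (\<Union>a\<in>A. C a)"
      using False insert.prems by auto
    ultimately have "\<exists>b\<in>A. \<exists>W'. openin X W' \<and> W' \<noteq> {} \<and> W' \<subseteq> W - C a \<and> W' \<subseteq> C b"
      using insert.prems(3) by (intro insert.IH) auto
    then show ?thesis
      by blast
  qed
qed auto

lemma (in topological_group) continuous_map_eval_word: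
  "continuous_map (product_topology (\<lambda>_. T) (UNIV :: nat set)) T (\<lambda>g. eval_word G g w)"
proof (induction w)
  case (Var i)
  show ?case
    using continuous_map_product_projection[of i UNIV "\<lambda>_. T"] by simp
qed (auto intro: continuous_map_group simp: topspace_eq_carrier)

context profinite_group
begin

lemma closedin_open_normal:
  assumes "open_normal U"
  shows "closedin T U"
proof -
  note UD = open_normalD[OF assms]
  have "T closure_of U \<subseteq> U"
  proof
    fix x assume "x \<in> T closure_of U"
    then obtain a where "x \<in> carrier G" "a \<in> U" "U #> a = U #> x"
      using in_closure_iff[OF UD(4)] assms by blast
    then show "x \<in> U"
      using rcos_self[OF _ UD(2), of x] coset_join2[OF _ UD(2), of a] UD(4) by auto
  qed
  moreover have "U \<subseteq> T closure_of U"
    using UD(4) by (intro closure_of_subset) (simp add: topspace_eq_carrier)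
  ultimately show ?thesis
    using closedin_closure_of[of T U] by simp
qed

lemma closed_subgroup_open_normal: "open_normal U \<Longrightarrow> closed_subgroup U G T"
  by (simp add: closed_subgroup_def closedin_open_normal open_normalD)

lemma rcos_conj:
  assumes "K \<lhd> G" "e \<in> K" "x \<in> carrier G"
  shows "K #> (e \<otimes> x \<otimes> inv e) = K #> x"
proof -
  interpret normal K G by fact
  have ec: "e \<in> carrier G"
    using assms(2) subset by blast
  have "e \<otimes> (x \<otimes> inv e \<otimes> inv x) \<in> K"
    using assms inv_op_closed2[OF assms(3), of "inv e"] by auto
  then show ?thesis
    using assms ec by (subst rcos_eq_iff[OF subgroup_axioms]) (auto simp: m_assoc)
qed

text \<open>The tuples congruent to \<open>a\<close> modulo \<open>K\<close> on
  \<open>vars w\<close> form an open set, covered by the closed preimages of the \<open>R k\<close>.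
  One preimage contains a nonempty open part of it, and there a basic box can be shrunk to cosets of
  a single open normal subgroup, as \<open>w\<close> has finitely many variables.\<close>

lemma word_values_locally_covered:
  assumes A: "finite A" "\<And>k. k \<in> A \<Longrightarrow> closedin T (R k)"
    and cover: "word_values G w \<subseteq> (\<Union>k\<in>A. R k)"
    and K: "open_normal K" and a: "\<And>j. a j \<in> carrier G"
  shows "\<exists>k\<in>A. \<exists>b M. open_normal M \<and> M \<subseteq> K \<and> (\<forall>j. b j \<in> carrier G) \<and>
    (\<forall>j\<in>vars w. K #> b j = K #> a j) \<and>
    (\<forall>g. (\<forall>j. g j \<in> carrier G) \<longrightarrow> (\<forall>j\<in>vars w. M #> g j = M #> b j) \<longrightarrow> eval_word G g w \<in> R k)"
proof -
  note KD = open_normalD[OF K]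
  define P where "P = product_topology (\<lambda>_. T) (UNIV :: nat set)"
  have top: "topspace P = {x. \<forall>i. x i \<in> carrier G}"
    by (auto simp: P_def topspace_eq_carrier PiE_def Pi_def)
  define S where "S j = (if j \<in> vars w then K #> a j else carrier G)" for j
  define W where "W = PiE UNIV S"
  have "finite {j. S j \<noteq> carrier G}"
    by (rule finite_subset[OF _ finite_vars[of w]]) (auto simp: S_def)
  moreover have "openin T (S j)" for j
    using openin_rcos[OF KD(2,3) a] openin_carrier by (auto simp: S_def)
  ultimately have W: "openin P W"
    by (simp add: W_def P_def openin_PiE_gen topspace_eq_carrier)
  have "a \<in> W"
    using a rcos_self[OF a KD(2)] by (auto simp: W_def S_def)
  define C where "C k = {g \<in> topspace P. eval_word G g w \<in> R k}" for k
  have C: "closedin P (C k)" if "k \<in> A" for k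
    unfolding C_def
    by (rule closedin_continuous_map_preimage[OF _ A(2)[OF that]]) (simp add: P_def continuous_map_eval_word)
  have "W \<subseteq> (\<Union>k\<in>A. C k)"
  proof
    fix g assume "g \<in> W"
    then have g: "g \<in> topspace P"
      using openin_subset[OF W] by blast
    then have "eval_word G g w \<in> word_values G w"
      by (auto simp: word_values_def top)
    then show "g \<in> (\<Union>k\<in>A. C k)"
      using cover g by (auto simp: C_def)
  qed
  then obtain k W' where k: "k \<in> A" and W': "openin P W'" "W' \<noteq> {}" "W' \<subseteq> W" "W' \<subseteq> C k"
    using open_finite_closed_cover[of A P W C] A(1) W C \<open>a \<in> W\<close> by blast
  then obtain b where b: "b \<in> W'" by blast
  have "\<forall>x\<in>W'. \<exists>U. finite {i \<in> UNIV. U i \<noteq> topspace T} \<and> (\<forall>i\<in>UNIV. openin T (U i)) \<and>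
      x \<in> PiE UNIV U \<and> PiE UNIV U \<subseteq> W'"
    using W'(1) unfolding P_def openin_product_topology_alt .
  from this[THEN bspec, OF b] obtain B where "finite {i \<in> UNIV. B i \<noteq> topspace T} \<and> (\<forall>i\<in>UNIV. openin T (B i)) \<and>
      b \<in> PiE UNIV B \<and> PiE UNIV B \<subseteq> W'"
    by (rule exE)
  then have B: "\<And>j. openin T (B j)" "b \<in> PiE UNIV B" "PiE UNIV B \<subseteq> W'"
    by simp_all
  have bc: "b j \<in> carrier G" for j
    using b W' openin_subset[OF W'(1)] by (auto simp: top)
  have "\<exists>U. open_normal U \<and> (\<forall>x\<in>carrier G. U #> x = U #> b j \<longrightarrow> x \<in> B j)" for j
  proof -
    have "openin T {y \<in> carrier G. y \<otimes> b j \<in> B j}"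
      using bc B(1) by (intro openin_vimage continuous_map_group) auto
    moreover have "\<one> \<in> {y \<in> carrier G. y \<otimes> b j \<in> B j}"
      using bc B(2) by auto
    ultimately obtain U where U: "open_normal U" "U \<subseteq> {y \<in> carrier G. y \<otimes> b j \<in> B j}"
      using open_normal_base by blast
    have "x \<in> B j" if x: "x \<in> carrier G" "U #> x = U #> b j" for x
    proof -
      have "x \<otimes> inv b j \<in> U"
        using x bc[of j] rcos_eq_iff[OF open_normalD(2)[OF U(1)]] by simp
      then have "(x \<otimes> inv b j) \<otimes> b j \<in> B j"
        using U(2) by auto
      then show ?thesis
        using x bc[of j] by (simp add: m_assoc)
    qed
    then show ?thesis
      using U(1) by blast
  qed
  then obtain U where U: "\<And>j. open_normal (U j)" "\<And>j x. x \<in> carrier G \<Longrightarrow> U j #> x = U j #> b j \<Longrightarrow> x \<in> B j"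
    by metis
  obtain M0 where M0: "open_normal M0" "\<And>j. j \<in> vars w \<Longrightarrow> M0 \<subseteq> U j"
    using open_normal_INT[OF finite_vars[of w], of U] U(1) by blast
  define M where "M = M0 \<inter> K"
  have M: "open_normal M" "M \<subseteq> K" "\<And>j. j \<in> vars w \<Longrightarrow> M \<subseteq> U j"
    using M0 K open_normal_Int by (auto simp: M_def)
  have "eval_word G g w \<in> R k" if g: "\<And>j. g j \<in> carrier G" and gb: "\<And>j. j \<in> vars w \<Longrightarrow> M #> g j = M #> b j" for g
  proof -
    \<comment> \<open>The box \<open>B\<close> may also restrict positions that do not occur in
      \<open>w\<close>; filling these from \<open>b\<close> puts the tuple in the box without
      changing the value.\<close>
    define f where "f j = (if j \<in> vars w then g j else b j)" for j
    have "f j \<in> B j" for j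
    proof (cases "j \<in> vars w")
      case True
      then have "U j #> g j = U j #> b j"
        using rcos_cong_mono[OF U(1) M(1) M(3)[OF True] g bc gb] by blast
      then show ?thesis
        using U(2)[OF g] True by (simp add: f_def)
    qed (use B(2) in \<open>auto simp: f_def\<close>)
    then have "f \<in> C k"
      using B(3) W'(4) by blast
    moreover have "eval_word G f w = eval_word G g w"
      by (rule eval_word_cong) (simp add: f_def)
    ultimately show ?thesis
      by (simp add: C_def)
  qed
  moreover have "K #> b j = K #> a j" if "j \<in> vars w" for j
  proof -
    have "b j \<in> S j"
      using b W' by (auto simp: W_def)
    then show ?thesis
      using that repr_independence[OF _ a KD(2), of "b j"] by (simp add: S_def)
  qed
  ultimately show ?thesis
    using k M bc by (intro bexI[of _ k] exI[of _ b] exI[of _ M]) auto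
qed

lemma top_generate_conj:
  assumes C: "closed_subgroup C G T" and S: "S \<subseteq> carrier G" and x: "x \<in> carrier G"
    and conj: "\<And>s. s \<in> S \<Longrightarrow> x \<otimes> s \<otimes> inv x \<in> C" and y: "y \<in> top_generate G T S"
  shows "x \<otimes> y \<otimes> inv x \<in> C"
proof -
  note CD = closed_subgroupD[OF C]
  define D where "D = {y \<in> carrier G. x \<otimes> y \<otimes> inv x \<in> C}"
  have "subgroup D G"
  proof
    show "D \<subseteq> carrier G" "\<one> \<in> D"
      using x CD(4) by (auto simp: D_def)
    show "y \<otimes> z \<in> D" if "y \<in> D" "z \<in> D" for y z
    proof -
      have "(x \<otimes> y \<otimes> inv x) \<otimes> (x \<otimes> z \<otimes> inv x) \<in> C"
        using that CD(5)[of "x \<otimes> y \<otimes> inv x" "x \<otimes> z \<otimes> inv x"] by (simp add: D_def)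
      also have "(x \<otimes> y \<otimes> inv x) \<otimes> (x \<otimes> z \<otimes> inv x) = x \<otimes> (y \<otimes> z) \<otimes> inv x"
        using that x by (simp add: D_def m_assoc)
      finally show ?thesis
        using that by (simp add: D_def)
    qed
    show "inv y \<in> D" if "y \<in> D" for y
    proof -
      have "inv (x \<otimes> y \<otimes> inv x) \<in> C"
        using that CD(6)[of "x \<otimes> y \<otimes> inv x"] by (simp add: D_def)
      also have "inv (x \<otimes> y \<otimes> inv x) = x \<otimes> inv y \<otimes> inv x"
        using that x by (simp add: D_def m_assoc inv_mult_group)
      finally show ?thesis
        using that by (simp add: D_def)
    qed
  qed
  moreover have "continuous_map T T (\<lambda>y. x \<otimes> y \<otimes> inv x)"
    using x by (intro continuous_map_group) auto
  then have "closedin T D"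
    using closedin_continuous_map_preimage[of T T _ C] CD(2) by (simp add: D_def topspace_eq_carrier)
  ultimately have "closed_subgroup D G T"
    by (simp add: closed_subgroup_def)
  then have "top_generate G T S \<subseteq> D"
    using S conj by (intro top_generate_minimal) (auto simp: D_def)
  then show ?thesis
    using y by (auto simp: D_def)
qed

text \<open>Since all \<open>M a\<close> lie in \<open>K\<close> and are normalized by
  \<open>K\<close>, each normalizes the product built before it, so \<open>rank_le_set_mult\<close>
  applies repeatedly.\<close>

lemma finite_rank_normal_product:
  assumes K: "closed_subgroup K G T" and "finite A"
    and "\<And>a. a \<in> A \<Longrightarrow> \<exists>r. rank_le (M a) r" "\<And>a. a \<in> A \<Longrightarrow> M a \<subseteq> K"
    and "\<And>a x y. a \<in> A \<Longrightarrow> x \<in> K \<Longrightarrow> y \<in> M a \<Longrightarrow> x \<otimes> y \<otimes> inv x \<in> M a"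
  shows "\<exists>P r. rank_le P r \<and> P \<subseteq> K \<and> (\<forall>x\<in>K. \<forall>y\<in>P. x \<otimes> y \<otimes> inv x \<in> P) \<and> (\<forall>a\<in>A. M a \<subseteq> P)"
  using assms(2-)
proof (induction A rule: finite_induct)
  note KD = closed_subgroupD[OF K]
  case empty
  then show ?case
    using rank_le_trivial KD(3,4) by (intro exI[of _ "{\<one>}"] exI[of _ 0]) auto
next
  note KD = closed_subgroupD[OF K]
  case (insert a A)
  have "\<exists>P r. rank_le P r \<and> P \<subseteq> K \<and> (\<forall>x\<in>K. \<forall>y\<in>P. x \<otimes> y \<otimes> inv x \<in> P) \<and> (\<forall>a\<in>A. M a \<subseteq> P)"
    using insert.prems by (intro insert.IH) blast+
  then obtain P r where P: "rank_le P r" "P \<subseteq> K" "\<And>x y. x \<in> K \<Longrightarrow> y \<in> P \<Longrightarrow> x \<otimes> y \<otimes> inv x \<in> P" "\<forall>a\<in>A. M a \<subseteq> P"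
    by blast
  obtain q where q: "rank_le (M a) q"
    using insert.prems(1) by blast
  have MK: "M a \<subseteq> K"
    using insert.prems(2) by blast
  have c: "closed_subgroup (M a) G T" "closed_subgroup P G T"
    using q P(1) by (auto simp: rank_le_def)
  have "rank_le (M a <#> P) (q + r)"
    by (rule rank_le_set_mult[OF q P(1)]) (use MK P(3) in blast)
  moreover have "M a <#> P \<subseteq> K"
    using MK P(2) KD(5) by (auto elim!: set_multE)
  moreover have "x \<otimes> y \<otimes> inv x \<in> M a <#> P" if x: "x \<in> K" and y: "y \<in> M a <#> P" for x y
  proof -
    from y obtain m p where mp: "m \<in> M a" "p \<in> P" "y = m \<otimes> p"
      by (rule set_multE)
    then have "m \<in> carrier G" "p \<in> carrier G" "x \<in> carrier G"
      using MK P(2) KD(3) x by auto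
    then have "x \<otimes> y \<otimes> inv x = (x \<otimes> m \<otimes> inv x) \<otimes> (x \<otimes> p \<otimes> inv x)"
      using mp by (simp add: m_assoc)
    then show ?thesis
      using insert.prems(3)[OF _ x mp(1)] P(3)[OF x mp(2)] by (auto intro: set_multI)
  qed
  moreover have "\<forall>b\<in>insert a A. M b \<subseteq> M a <#> P"
    using subset_set_mult[OF c] P(4) by auto
  ultimately show ?case
    by blast
qed

end

section \<open>Downward induction on the set of restricted positions\<close>

definition (in topological_group) small_on :: "gword \<Rightarrow> nat set \<Rightarrow> 'a set \<Rightarrow> 'a set \<Rightarrow> bool" where
  "small_on w I K N \<longleftrightarrow>
     (\<forall>g. (\<forall>i. g i \<in> carrier G) \<longrightarrow> (\<forall>i\<in>I. g i \<in> K) \<longrightarrow> eval_word G g w \<in> N)"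

text \<open>The subgroup \<open>N\<close> is required to be normal in all of \<open>G\<close>: the
  next step of the induction compares values modulo \<open>N\<close>, and the subgroups found for
  different sets of positions are multiplied together.\<close>

definition (in topological_group) virtually_small :: "gword \<Rightarrow> nat set \<Rightarrow> bool" where
  "virtually_small w I \<longleftrightarrow>
     (\<exists>K N s. open_normal K \<and> N \<lhd> G \<and> rank_le N s \<and> small_on w I K N)"

context profinite_group
begin

lemma small_on_mono: "small_on w I K N \<Longrightarrow> K' \<subseteq> K \<Longrightarrow> N \<subseteq> N' \<Longrightarrow> small_on w I K' N'"
  unfolding small_on_def by blast

lemma normal_set_mult:
  assumes M: "M \<lhd> G" "closed_subgroup M G T" and N: "N \<lhd> G" "closed_subgroup N G T"
  shows "M <#> N \<lhd> G"
proof -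
  interpret M: normal M G by fact
  interpret N: normal N G by fact
  have "closed_subgroup (M <#> N) G T"
    by (rule closed_subgroup_set_mult[OF M(2) N(2) N.inv_op_closed2]) auto
  moreover have "x \<otimes> y \<otimes> inv x \<in> M <#> N" if x: "x \<in> carrier G" and y: "y \<in> M <#> N" for x y
  proof -
    from y obtain m n where mn: "m \<in> M" "n \<in> N" "y = m \<otimes> n"
      by (rule set_multE)
    then have "x \<otimes> y \<otimes> inv x = (x \<otimes> m \<otimes> inv x) \<otimes> (x \<otimes> n \<otimes> inv x)"
      using x M.subset N.subset by (simp add: m_assoc subset_iff)
    then show ?thesis
      using M.inv_op_closed2[OF x mn(1)] N.inv_op_closed2[OF x mn(2)] by (simp add: set_multI)
  qed
  ultimately show ?thesis
    by (simp add: normal_inv_iff closed_subgroupD)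
qed

lemma virtually_small_uniform:
  assumes "finite J" "\<And>j. j \<in> J \<Longrightarrow> virtually_small w (I j)"
  shows "\<exists>K N s. open_normal K \<and> N \<lhd> G \<and> rank_le N s \<and> (\<forall>j\<in>J. small_on w (I j) K N)"
  using assms
proof (induction J rule: finite_induct)
  case empty
  then show ?case
    using open_normal_carrier one_is_normal rank_le_trivial by blast
next
  case (insert a J)
  have "\<exists>K N s. open_normal K \<and> N \<lhd> G \<and> rank_le N s \<and> (\<forall>j\<in>J. small_on w (I j) K N)"
    using insert.prems by (intro insert.IH) auto
  then obtain K N s where 1: "open_normal K" "N \<lhd> G" "rank_le N s" "\<And>j. j \<in> J \<Longrightarrow> small_on w (I j) K N"
    by blast
  have "virtually_small w (I a)"
    using insert.prems by blast
  then obtain K' N' s' where 2: "open_normal K'" "N' \<lhd> G" "rank_le N' s'" "small_on w (I a) K' N'"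
    unfolding virtually_small_def by blast
  have c: "closed_subgroup N G T" "closed_subgroup N' G T"
    using 1 2 by (auto simp: rank_le_def)
  have "rank_le (N <#> N') (s + s')"
    by (rule rank_le_set_mult[OF 1(3) 2(3) normal.inv_op_closed2[OF 2(2)]]) (use closed_subgroupD[OF c(1)] in auto)
  moreover have "N <#> N' \<lhd> G"
    by (rule normal_set_mult[OF 1(2) c(1) 2(2) c(2)])
  moreover have "\<forall>j\<in>insert a J. small_on w (I j) (K \<inter> K') (N <#> N')"
    using small_on_mono[OF 1(4), of _ "K \<inter> K'" "N <#> N'"] small_on_mono[OF 2(4), of "K \<inter> K'" "N <#> N'"]
      subset_set_mult[OF c] by auto
  ultimately show ?case
    using open_normal_Int[OF 1(1) 2(1)] by blast
qed

text \<open>The cover provides a box inside the coset pattern of \<open>a\<close> whose values lie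
  in some \<open>R k\<close>, but centred at an uncontrolled tuple \<open>b\<close>. On
  \<open>I\<close>, \<open>linear_steps\<close> recentres it at \<open>M\<close>; outside
  \<open>I\<close> it keeps the cosets modulo \<open>K\<close>, and by \<open>small\<close> only
  these matter modulo \<open>N\<close>. So \<open>R k <#> N\<close> receives all values of the
  pattern.\<close>

lemma values_on_cosets_finite_rank:
  assumes w: "outer_commutator_word n w" and A: "finite A" and R: "\<And>k. k \<in> A \<Longrightarrow> \<exists>r. rank_le (R k) r"
    and cover: "word_values G w \<subseteq> (\<Union>k\<in>A. R k)"
    and I: "I \<subseteq> vars w" and K: "open_normal K" and N: "N \<lhd> G" "rank_le N s"
    and small: "\<And>j. j \<in> vars w - I \<Longrightarrow> small_on w (insert j I) K N"
    and a: "\<And>j. a j \<in> carrier G" "\<And>j. j \<in> I \<Longrightarrow> a j \<in> K"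
  shows "\<exists>M Q r. open_normal M \<and> M \<subseteq> K \<and> rank_le Q r \<and>
    (\<forall>g. (\<forall>j. g j \<in> carrier G) \<longrightarrow> (\<forall>i\<in>I. g i \<in> M) \<longrightarrow> (\<forall>j\<in>vars w - I. K #> g j = K #> a j)
      \<longrightarrow> eval_word G g w \<in> Q)"
proof -
  note KD = open_normalD[OF K]
  interpret N: normal N G by (rule N(1))
  interpret K: normal K G by (rule KD(1))
  have Rc: "closed_subgroup (R k) G T" if "k \<in> A" for k
    using R[OF that] by (auto simp: rank_le_def)
  have "\<exists>k\<in>A. \<exists>b M. open_normal M \<and> M \<subseteq> K \<and> (\<forall>j. b j \<in> carrier G) \<and>
    (\<forall>j\<in>vars w. K #> b j = K #> a j) \<and>
    (\<forall>g. (\<forall>j. g j \<in> carrier G) \<longrightarrow> (\<forall>j\<in>vars w. M #> g j = M #> b j) \<longrightarrow> eval_word G g w \<in> R k)"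
    by (rule word_values_locally_covered[OF A closed_subgroupD(2)[OF Rc] cover K a(1)])
  then obtain k b M where k: "k \<in> A" and M: "open_normal M" "M \<subseteq> K" and b: "\<And>j. b j \<in> carrier G"
    and ba: "\<And>j. j \<in> vars w \<Longrightarrow> K #> b j = K #> a j"
    and bR: "\<And>g. (\<forall>j. g j \<in> carrier G) \<longrightarrow> (\<forall>j\<in>vars w. M #> g j = M #> b j) \<longrightarrow> eval_word G g w \<in> R k"
    by (elim bexE exE conjE) (rule that, assumption+, erule spec, erule (1) bspec, erule spec)
  note MD = open_normalD[OF M(1)]
  interpret h: group_hom G "G Mod M" "\<lambda>x. M #> x"
    by (rule open_normal_hom[OF M(1)])
  have bI: "b j \<in> K" if "j \<in> I" for j
  proof -
    have "K #> b j = K"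
      using ba[of j] that I coset_join2[OF a(1) KD(2) a(2)] by auto
    then show ?thesis
      using rcos_self[OF b KD(2)] by blast
  qed
  have "\<exists>b'. (\<forall>j\<in>I. M #> b' j = \<one>\<^bsub>G Mod M\<^esub>) \<and> (\<forall>j\<in>-I. \<exists>e\<in>K. b' j = e \<otimes> b j \<otimes> inv e) \<and> (\<forall>j\<in>I. b' j \<in> K) \<and>
    (\<forall>g. (\<forall>j. g j \<in> carrier G) \<longrightarrow> (\<forall>j\<in>vars w. M #> g j = M #> b' j) \<longrightarrow> eval_word G g w \<in> R k)"
    by (rule h.linear_steps[where b = b, OF w KD(1) closed_subgroupD(1)[OF Rc[OF k]] finite_subset[OF I finite_vars] I b bI])
       (use bR in auto)
  then obtain b' where b'I: "\<And>j. j \<in> I \<Longrightarrow> M #> b' j = \<one>\<^bsub>G Mod M\<^esub>"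
    and b'e: "\<And>j. j \<notin> I \<Longrightarrow> \<exists>e\<in>K. b' j = e \<otimes> b j \<otimes> inv e" and b'K: "\<And>j. j \<in> I \<Longrightarrow> b' j \<in> K"
    and b'R: "\<And>g. (\<forall>j. g j \<in> carrier G) \<longrightarrow> (\<forall>j\<in>vars w. M #> g j = M #> b' j) \<longrightarrow> eval_word G g w \<in> R k"
    by blast
  have b'c: "b' j \<in> carrier G" for j
  proof (cases "j \<in> I")
    case False
    then show ?thesis
      using b'e[OF False] b[of j] KD(4) by auto
  qed (use b'K KD(4) in auto)
  obtain r where r: "rank_le (R k) r"
    using R[OF k] by blast
  note RD = closed_subgroupD[OF Rc[OF k]]
  have "rank_le (R k <#> N) (r + s)"
    by (rule rank_le_set_mult[OF r N(2) N.inv_op_closed2]) (use RD in auto)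
  moreover have "eval_word G g w \<in> R k <#> N"
    if g: "\<And>j. g j \<in> carrier G" and gI: "\<And>i. i \<in> I \<Longrightarrow> g i \<in> M"
      and ga: "\<And>j. j \<in> vars w - I \<Longrightarrow> K #> g j = K #> a j" for g
  proof -
    \<comment> \<open>\<open>f\<close> takes the entries of \<open>g\<close> on \<open>I\<close> and
      those of the centre \<open>b'\<close> elsewhere, so it lies in the box, and on
      \<open>vars w - I\<close> it agrees with \<open>g\<close> modulo \<open>K\<close>.\<close>
    define f where "f j = (if j \<in> I then g j else b' j)" for j
    have f: "f j \<in> carrier G" for j
      using g b'c by (simp add: f_def)
    have fR: "eval_word G f w \<in> R k"
    proof -
      have "M #> f j = M #> b' j" for j
        using b'I[of j] gI[of j] coset_join2[OF g MD(2), of j] by (simp add: f_def)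
      then show ?thesis
        using b'R[of f] f by simp
    qed
    have "N #> eval_word G g w = N #> eval_word G f w"
    proof (rule eval_word_rcos_cong[OF w N(1) KD(1) I])
      show "eval_word G g w \<in> N"
        if "j \<in> vars w - I" "\<And>i. g i \<in> carrier G" "\<And>i. i \<in> insert j I \<Longrightarrow> g i \<in> K" for j g
        using small[OF that(1)] that(2,3) unfolding small_on_def by blast
      show "K #> g j = K #> f j" if j: "j \<in> vars w - I" for j
      proof -
        obtain e where "e \<in> K" "b' j = e \<otimes> b j \<otimes> inv e"
          using b'e j by blast
        then show ?thesis
          using j ga[OF j] ba[of j] rcos_conj[OF KD(1) _ b, of e j] by (simp add: f_def)
      qed
      show "f i \<in> K" if "i \<in> I" for i
        using that gI M(2) by (auto simp: f_def)
    qed (use f g in \<open>auto simp: f_def\<close>)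
    then have "eval_word G g w \<otimes> inv eval_word G f w \<in> N"
      using f g by (simp add: rcos_eq_iff N.subgroup_axioms)
    \<comment> \<open>The factor from \<open>N\<close> stands on the wrong side for
      \<open>R k <#> N\<close>; normality of \<open>N\<close> moves it to the right.\<close>
    then have "inv eval_word G f w \<otimes> (eval_word G g w \<otimes> inv eval_word G f w) \<otimes> eval_word G f w \<in> N"
      using f by (intro N.inv_op_closed1) auto
    from set_multI[OF fR this] show ?thesis
      using f g by (simp add: m_assoc)
  qed
  ultimately show ?thesis
    using M by - (rule exI[of _ M], rule exI[of _ "R k <#> N"], rule exI[of _ "r + s"], auto)
qed

lemma finite_transversal:
  assumes "open_normal K"
  obtains S where "finite S" "S \<subseteq> carrier G" "\<And>x. x \<in> carrier G \<Longrightarrow> \<exists>t\<in>S. K #> x = K #> t"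
proof -
  obtain S where "S \<subseteq> carrier G" "finite S" "(\<lambda>x. K #> x) ` carrier G = (\<lambda>x. K #> x) ` S"
    using finite_subset_image[OF finite_rcosets_open_normal[OF assms] order_refl] by blast
  then show thesis
    by (intro that[of S]) (auto dest: equalityD1 simp: image_subset_iff image_iff)
qed

text \<open>Invariance is reached in two stages. Conjugation by \<open>K\<close> preserves the
  values with a fixed pattern of cosets, which suffices to bound the rank of the product of the
  subgroups that they generate. Conjugation by all of \<open>G\<close> preserves the set of values
  with entries from \<open>L\<close> on \<open>I\<close>, so these generate a normal subgroup of
  \<open>G\<close>; it lies in that product and inherits its rank bound.\<close>

lemma virtually_small_step:
  assumes w: "outer_commutator_word n w" and A: "finite A" and R: "\<And>k. k \<in> A \<Longrightarrow> \<exists>r. rank_le (R k) r"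
    and cover: "word_values G w \<subseteq> (\<Union>k\<in>A. R k)"
    and I: "I \<subseteq> vars w" "I \<noteq> {}"
    and small: "\<And>j. j \<in> vars w - I \<Longrightarrow> virtually_small w (insert j I)"
  shows "virtually_small w I"
proof -
  obtain i where i: "i \<in> I" "i \<in> vars w"
    using I by blast
  obtain K N s where K: "open_normal K" and N: "N \<lhd> G" "rank_le N s"
    and smallK: "\<And>j. j \<in> vars w - I \<Longrightarrow> small_on w (insert j I) K N"
    using virtually_small_uniform[of "vars w - I" w "\<lambda>j. insert j I"] small finite_vars by auto
  note KD = open_normalD[OF K]
  interpret K: normal K G by (rule KD(1))
  obtain S where S: "finite S" "S \<subseteq> carrier G" "\<And>x. x \<in> carrier G \<Longrightarrow> \<exists>t\<in>S. K #> x = K #> t"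
    using finite_transversal[OF K] by blast
  define B where "B = PiE (vars w - I) (\<lambda>_. S)"
  have finB: "finite B"
    unfolding B_def using finite_vars S(1) by (intro finite_PiE) auto
  \<comment> \<open>On \<open>I\<close> the value \<open>\<one>\<close> lies in \<open>K\<close>, as
    \<open>values_on_cosets_finite_rank\<close> demands; outside \<open>vars w\<close> it only has
    to be in the carrier.\<close>
  define a' where "a' a j = (if j \<in> vars w - I then a j else \<one>)" for a :: "nat \<Rightarrow> 'a" and j
  have a'c: "a' a j \<in> carrier G" if "a \<in> B" for a j
    using that S(2) by (auto simp: a'_def B_def)
  define Q where "Q a M X r \<longleftrightarrow> open_normal M \<and> M \<subseteq> K \<and> rank_le X r \<and>
    (\<forall>g. (\<forall>j. g j \<in> carrier G) \<longrightarrow> (\<forall>i\<in>I. g i \<in> M) \<longrightarrow> (\<forall>j\<in>vars w - I. K #> g j = K #> a j)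
      \<longrightarrow> eval_word G g w \<in> X)" for a M X r
  have "\<exists>M X r. Q a M X r" if "a \<in> B" for a
  proof -
    have "\<exists>M X r. Q (a' a) M X r"
      unfolding Q_def
      by (rule values_on_cosets_finite_rank[OF w A R cover I(1) K N smallK a'c[OF that]])
         (use KD in \<open>auto simp: a'_def\<close>)
    then show ?thesis
      by (simp add: Q_def a'_def)
  qed
  then obtain M X r where MXr: "\<And>a. a \<in> B \<Longrightarrow> Q a (M a) (X a) (r a)"
    by metis
  obtain M0 where M0: "open_normal M0" "\<And>a. a \<in> B \<Longrightarrow> M0 \<subseteq> M a"
    using open_normal_INT[OF finB, of M] MXr unfolding Q_def by blast
  define L where "L = M0 \<inter> K"
  have L: "open_normal L" "L \<subseteq> K" "\<And>a. a \<in> B \<Longrightarrow> L \<subseteq> M a"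
    using M0 K by (auto simp: L_def open_normal_Int)
  interpret L: normal L G by (rule open_normalD(1)[OF L(1)])
  define V where "V a = {eval_word G g w |g. (\<forall>j. g j \<in> carrier G) \<and> (\<forall>i\<in>I. g i \<in> L) \<and>
      (\<forall>j\<in>vars w - I. K #> g j = K #> a j)}" for a
  define W where "W = {eval_word G g w |g. (\<forall>j. g j \<in> carrier G) \<and> (\<forall>i\<in>I. g i \<in> L)}"
  \<comment> \<open>This is where \<open>I\<close> must be nonempty: the entry at \<open>i\<close>
    lies in \<open>L\<close>, hence in \<open>K\<close>.\<close>
  have VK: "V a \<subseteq> K" for a
  proof
    fix v assume "v \<in> V a"
    then obtain g where "v = eval_word G g w" "\<And>j. g j \<in> carrier G" "g i \<in> K"
      using i L(2) unfolding V_def by blast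
    then show "v \<in> K"
      using eval_word_normal[OF w KD(1), of g i] i by simp
  qed
  then have VG: "V a \<subseteq> carrier G" for a
    using KD(4) by blast
  have Kc: "closed_subgroup K G T"
    by (rule closed_subgroup_open_normal[OF K])
  have VX: "V a \<subseteq> X a" if "a \<in> B" for a
    using MXr[OF that] L(3)[OF that] unfolding Q_def V_def by blast
  have "\<exists>P r. rank_le P r \<and> P \<subseteq> K \<and> (\<forall>x\<in>K. \<forall>y\<in>P. x \<otimes> y \<otimes> inv x \<in> P) \<and> (\<forall>a\<in>B. top_generate G T (V a) \<subseteq> P)"
  proof (rule finite_rank_normal_product[OF Kc finB])
    fix a assume a: "a \<in> B"
    have X: "rank_le (X a) (r a)" "closed_subgroup (X a) G T"
      using MXr[OF a] by (auto simp: Q_def rank_le_def)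
    show "\<exists>r. rank_le (top_generate G T (V a)) r"
      using rank_le_mono[OF X(1) closed_subgroup_top_generate[OF VG] top_generate_minimal[OF X(2) VX[OF a]]] by blast
    show "top_generate G T (V a) \<subseteq> K"
      by (rule top_generate_minimal[OF Kc VK])
    show "x \<otimes> y \<otimes> inv x \<in> top_generate G T (V a)" if x: "x \<in> K" and y: "y \<in> top_generate G T (V a)" for x y
    proof (rule top_generate_conj[OF closed_subgroup_top_generate[OF VG] VG _ _ y])
      show xG: "x \<in> carrier G"
        using x KD(4) by blast
      fix v assume "v \<in> V a"
      then obtain g where v: "v = eval_word G g w" and g: "\<And>j. g j \<in> carrier G" "\<And>i. i \<in> I \<Longrightarrow> g i \<in> L"
        "\<And>j. j \<in> vars w - I \<Longrightarrow> K #> g j = K #> a j"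
        unfolding V_def by blast
      have "x \<otimes> v \<otimes> inv x = eval_word G (\<lambda>j. x \<otimes> g j \<otimes> inv x) w"
        using v g xG by (simp add: eval_word_conj)
      moreover have "x \<otimes> g j \<otimes> inv x \<in> L" if "j \<in> I" for j
        using g(2)[OF that] xG by (intro L.inv_op_closed2)
      moreover have "K #> (x \<otimes> g j \<otimes> inv x) = K #> a j" if "j \<in> vars w - I" for j
        using rcos_conj[OF KD(1) x g(1), of j] g(3)[OF that] by simp
      ultimately have "x \<otimes> v \<otimes> inv x \<in> V a"
        using g xG unfolding V_def by blast
      then show "x \<otimes> v \<otimes> inv x \<in> top_generate G T (V a)"
        using subset_top_generate[OF VG] by blast
    qed
  qed
  then obtain P p where P: "rank_le P p" "\<And>a. a \<in> B \<Longrightarrow> top_generate G T (V a) \<subseteq> P"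
    by blast
  have Pc: "closed_subgroup P G T"
    using P(1) by (simp add: rank_le_def)
  have "W \<subseteq> P"
  proof
    fix v assume "v \<in> W"
    then obtain g where v: "v = eval_word G g w" and g: "\<And>j. g j \<in> carrier G" "\<And>i. i \<in> I \<Longrightarrow> g i \<in> L"
      unfolding W_def by blast
    have "\<forall>j. \<exists>t\<in>S. K #> g j = K #> t"
      using S(3) g(1) by blast
    then obtain t where t: "\<And>j. t j \<in> S" "\<And>j. K #> g j = K #> t j"
      by metis
    define a where "a = restrict t (vars w - I)"
    have "a \<in> B"
      using t by (simp add: a_def B_def)
    moreover have "v \<in> V a"
      using v g t unfolding V_def a_def by auto
    ultimately show "v \<in> P"
      using P(2)[of a] subset_top_generate[OF VG, of a] by blast
  qed
  moreover have WG: "W \<subseteq> carrier G"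
    unfolding W_def by auto
  ultimately have rank: "rank_le (top_generate G T W) p"
    using rank_le_mono[OF P(1) closed_subgroup_top_generate top_generate_minimal[OF Pc]] by blast
  have cW: "closed_subgroup (top_generate G T W) G T"
    by (rule closed_subgroup_top_generate[OF WG])
  have "x \<otimes> y \<otimes> inv x \<in> top_generate G T W" if x: "x \<in> carrier G" and y: "y \<in> top_generate G T W" for x y
  proof (rule top_generate_conj[OF cW WG x _ y])
    fix v assume "v \<in> W"
    then obtain g where v: "v = eval_word G g w" and g: "\<And>j. g j \<in> carrier G" "\<And>i. i \<in> I \<Longrightarrow> g i \<in> L"
      unfolding W_def by blast
    have "x \<otimes> v \<otimes> inv x = eval_word G (\<lambda>j. x \<otimes> g j \<otimes> inv x) w"
      using v g x by (simp add: eval_word_conj)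
    moreover have "x \<otimes> g j \<otimes> inv x \<in> L" if "j \<in> I" for j
      using g(2)[OF that] x by (intro L.inv_op_closed2)
    ultimately have "x \<otimes> v \<otimes> inv x \<in> W"
      using g x unfolding W_def by blast
    then show "x \<otimes> v \<otimes> inv x \<in> top_generate G T W"
      using subset_top_generate[OF WG] by blast
  qed
  then have "top_generate G T W \<lhd> G"
    using cW by (simp add: normal_inv_iff closed_subgroupD)
  moreover have "small_on w I L (top_generate G T W)"
    using subset_top_generate[OF WG] unfolding small_on_def W_def by blast
  ultimately show ?thesis
    using L(1) rank unfolding virtually_small_def by blast
qed

text \<open>One procyclic factor is adjoined at a time; it normalizes what has been built so far.\<close>

lemma finite_rank_adjoin_central:
  assumes N: "N \<lhd> G" "rank_le N s" and V: "V \<subseteq> carrier G" and "finite Z" "Z \<subseteq> generate G V"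
    and "\<And>z x. z \<in> Z \<Longrightarrow> x \<in> generate G V \<Longrightarrow> N #> (x \<otimes> z) = N #> (z \<otimes> x)"
  shows "\<exists>Y r. rank_le Y r \<and> N \<subseteq> Y \<and> Z \<subseteq> Y \<and> (\<forall>x\<in>generate G V. \<forall>y\<in>Y. x \<otimes> y \<otimes> inv x \<in> Y)"
  using assms(4-)
proof (induction Z rule: finite_induct)
  interpret N: normal N G by (rule N(1))
  case empty
  have "x \<otimes> y \<otimes> inv x \<in> N" if "x \<in> generate G V" "y \<in> N" for x y
    using N.inv_op_closed2[OF generate_in_carrier[OF V that(1)] that(2)] .
  then show ?case
    using N(2) by blast
next
  interpret N: normal N G by (rule N(1))
  let ?D = "generate G V"
  case (insert z Z)
  have "\<exists>Y r. rank_le Y r \<and> N \<subseteq> Y \<and> Z \<subseteq> Y \<and> (\<forall>x\<in>?D. \<forall>y\<in>Y. x \<otimes> y \<otimes> inv x \<in> Y)"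
    using insert.prems by (intro insert.IH) auto
  then obtain Y r where Y: "rank_le Y r" "N \<subseteq> Y" "Z \<subseteq> Y" "\<And>x y. x \<in> ?D \<Longrightarrow> y \<in> Y \<Longrightarrow> x \<otimes> y \<otimes> inv x \<in> Y"
    by blast
  have Yc: "closed_subgroup Y G T"
    using Y(1) by (simp add: rank_le_def)
  note YD = closed_subgroupD[OF Yc]
  have zD: "z \<in> ?D"
    using insert.prems by blast
  have Dc: "x \<in> ?D \<Longrightarrow> x \<in> carrier G" for x
    using generate_in_carrier[OF V] .
  have zG: "z \<in> carrier G" "{z} \<subseteq> carrier G"
    using Dc[OF zD] by auto
  let ?C = "top_generate G T {z}"
  have Cc: "closed_subgroup ?C G T"
    by (rule closed_subgroup_top_generate[OF zG(2)])
  note CD = closed_subgroupD[OF Cc]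
  \<comment> \<open>Powers of \<open>z\<close> normalize \<open>Y\<close> as elements of
    \<open>?D\<close>; limits of powers do too, because membership in the closed set
    \<open>Y\<close> can be tested modulo each \<open>U\<close>.\<close>
  have norm: "x \<otimes> y \<otimes> inv x \<in> Y" if x: "x \<in> ?C" and y: "y \<in> Y" for x y
  proof (rule in_closedI[OF YD(2)])
    have xy: "x \<in> carrier G" "y \<in> carrier G"
      using x y CD YD by auto
    then show "x \<otimes> y \<otimes> inv x \<in> carrier G"
      by simp
    fix U assume U: "open_normal U"
    interpret h: group_hom G "G Mod U" "\<lambda>x. U #> x"
      by (rule open_normal_hom[OF U])
    obtain a where a: "a \<in> generate G {z}" "U #> a = U #> x"
      using x U in_top_generate_iff[OF zG(2)] by blast
    have aD: "a \<in> ?D"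
      using a(1) generate_subgroup_incl[OF _ generate_is_subgroup[OF V], of "{z}"] zD by blast
    have "U #> (a \<otimes> y \<otimes> inv a) = U #> (x \<otimes> y \<otimes> inv x)"
      using xy Dc[OF aD] a(2) h.hom_mult[of "a \<otimes> y" "inv a"] h.hom_mult[of a y] h.hom_inv[of a]
        h.hom_mult[of "x \<otimes> y" "inv x"] h.hom_mult[of x y] h.hom_inv[of x] by simp
    then show "\<exists>a\<in>Y. U #> a = U #> (x \<otimes> y \<otimes> inv x)"
      using Y(4)[OF aD y] by blast
  qed
  have YYc: "closed_subgroup (?C <#> Y) G T"
    by (rule closed_subgroup_set_mult[OF Cc Yc norm])
  note YYD = closed_subgroupD[OF YYc]
  note sub = subset_set_mult[OF Cc Yc]
  have zYY: "z \<in> ?C <#> Y"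
    using subset_top_generate[OF zG(2)] sub(1) by blast
  have "rank_le (?C <#> Y) (1 + r)"
    by (rule rank_le_set_mult[OF rank_le_procyclic[OF zG(1)] Y(1) norm])
  moreover have "x \<otimes> y \<otimes> inv x \<in> ?C <#> Y" if x: "x \<in> ?D" and y: "y \<in> ?C <#> Y" for x y
  proof -
    have xG: "x \<in> carrier G"
      by (rule Dc[OF x])
    \<comment> \<open>Modulo \<open>N\<close> the element \<open>z\<close> commutes with
      \<open>x\<close>, and \<open>N\<close> is contained in \<open>Y\<close>, so the conjugate of
      \<open>z\<close> stays in the product.\<close>
    have "N #> (x \<otimes> z) = N #> (z \<otimes> x)"
      using insert.prems(2)[of z x] x by simp
    then have "(x \<otimes> z) \<otimes> inv (z \<otimes> x) \<in> N"
      using rcos_eq_iff[OF N.subgroup_axioms] xG zG by simp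
    then have "((x \<otimes> z) \<otimes> inv (z \<otimes> x)) \<otimes> z \<in> ?C <#> Y"
      using Y(2) sub(2) YYD(5) zYY by blast
    then have xzx: "x \<otimes> z \<otimes> inv x \<in> ?C <#> Y"
      using xG zG by (simp add: m_assoc inv_mult_group)
    from y obtain c d where cd: "c \<in> ?C" "d \<in> Y" "y = c \<otimes> d"
      by (rule set_multE)
    have "x \<otimes> c \<otimes> inv x \<in> ?C <#> Y"
      by (rule top_generate_conj[OF YYc zG(2) xG _ cd(1)]) (use xzx in auto)
    moreover have "x \<otimes> d \<otimes> inv x \<in> ?C <#> Y"
      using Y(4)[OF x cd(2)] sub(2) by blast
    ultimately have "(x \<otimes> c \<otimes> inv x) \<otimes> (x \<otimes> d \<otimes> inv x) \<in> ?C <#> Y"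
      by (rule YYD(5))
    moreover have "c \<in> carrier G" "d \<in> carrier G"
      using cd CD YD by auto
    ultimately show ?thesis
      using cd xG by (simp add: m_assoc)
  qed
  moreover have "N \<subseteq> ?C <#> Y" "insert z Z \<subseteq> ?C <#> Y"
    using sub Y(2,3) zYY by auto
  ultimately show ?case
    by (intro exI[of _ "?C <#> Y"] exI[of _ "1 + r"]) simp
qed

text \<open>Modulo \<open>N\<close>, the centralizer of the finite set \<open>S\<close> has finite index, and Schreier's argument
  yields finitely many generators for a central subgroup of finite index.\<close>

lemma finite_rank_finite_mod_normal:
  assumes N: "N \<lhd> G" "rank_le N s" and V: "V \<subseteq> carrier G"
    and conj: "\<And>x v. x \<in> carrier G \<Longrightarrow> v \<in> V \<Longrightarrow> x \<otimes> v \<otimes> inv x \<in> V"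
    and S: "finite S" "S \<subseteq> V" "\<And>v. v \<in> V \<Longrightarrow> \<exists>t\<in>S. N #> v = N #> t"
  shows "\<exists>r. rank_le (top_generate G T V) r"
proof -
  interpret N: normal N G by (rule N(1))
  interpret h: group_hom G "G Mod N" "\<lambda>x. N #> x"
    by (rule group_hom_rcos[OF N(1)])
  let ?D = "generate G V"
  have Dc: "x \<in> ?D \<Longrightarrow> x \<in> carrier G" for x
    using generate_in_carrier[OF V] .
  have Dsub: "subgroup ?D G"
    by (rule generate_is_subgroup[OF V])
  have VD: "v \<in> V \<Longrightarrow> v \<in> ?D" for v
    by (rule generate.incl)
  \<comment> \<open>\<open>f x\<close> records how \<open>x\<close> acts by conjugation on the
    finitely many classes of \<open>S\<close> modulo \<open>N\<close>; two elements with the same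
    record differ by an element centralizing \<open>S\<close> modulo \<open>N\<close>.\<close>
  define f where "f x = (\<lambda>t\<in>S. N #> (x \<otimes> t \<otimes> inv x))" for x
  have "f ` ?D \<subseteq> PiE S (\<lambda>_. (\<lambda>x. N #> x) ` S)"
  proof (intro image_subsetI)
    fix x assume x: "x \<in> ?D"
    have "N #> (x \<otimes> t \<otimes> inv x) \<in> (\<lambda>x. N #> x) ` S" if "t \<in> S" for t
      using S(3)[OF conj[OF Dc[OF x]], of t] S(2) that by auto
    then show "f x \<in> PiE S (\<lambda>_. (\<lambda>x. N #> x) ` S)"
      by (auto simp: f_def)
  qed
  then have "finite (f ` ?D)"
    by (rule finite_subset) (simp add: finite_PiE S(1))
  then obtain T0 where T0: "T0 \<subseteq> ?D" "finite T0" "f ` ?D = f ` T0"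
    using finite_subset_image[of "f ` ?D" f ?D] by blast
  \<comment> \<open>\<open>\<one>\<close> is added so that \<open>R <#> Y\<close> contains
    \<open>\<one>\<close>, from where all of \<open>?D\<close> is reached.\<close>
  define R where "R = insert \<one> T0"
  have R: "finite R" "R \<subseteq> ?D" "\<one> \<in> R"
    using T0 generate.one by (auto simp: R_def)
  have "\<forall>x\<in>?D. \<exists>t\<in>R. f x = f t"
    using T0(3) by (auto simp: R_def image_iff set_eq_iff)
  then obtain \<rho> where \<rho>: "\<And>x. x \<in> ?D \<Longrightarrow> \<rho> x \<in> R" "\<And>x. x \<in> ?D \<Longrightarrow> f x = f (\<rho> x)"
    by metis
  have central: "N #> (x \<otimes> (inv (\<rho> c) \<otimes> c)) = N #> ((inv (\<rho> c) \<otimes> c) \<otimes> x)" if c: "c \<in> ?D" and x: "x \<in> ?D" for c x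
  proof -
    let ?z = "inv (\<rho> c) \<otimes> c"
    have \<rho>c: "\<rho> c \<in> carrier G" "c \<in> carrier G"
      using \<rho>(1)[OF c] R Dc c by auto
    have zV: "N #> (v \<otimes> ?z) = N #> (?z \<otimes> v)" if v: "v \<in> V" for v
    proof -
      obtain t where t: "t \<in> S" "N #> v = N #> t"
        using S(3)[OF v] by blast
      have vt: "v \<in> carrier G" "t \<in> carrier G"
        using v t S(2) V by auto
      have "N #> (c \<otimes> t \<otimes> inv c) = N #> (\<rho> c \<otimes> t \<otimes> inv \<rho> c)"
        using fun_cong[OF \<rho>(2)[OF c], of t] t(1) by (simp add: f_def)
      then have "N #> (inv \<rho> c \<otimes> (c \<otimes> t \<otimes> inv c) \<otimes> c) = N #> (inv \<rho> c \<otimes> (\<rho> c \<otimes> t \<otimes> inv \<rho> c) \<otimes> c)"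
        using \<rho>c vt h.hom_mult by simp
      moreover have "inv \<rho> c \<otimes> (c \<otimes> t \<otimes> inv c) \<otimes> c = ?z \<otimes> t"
        "inv \<rho> c \<otimes> (\<rho> c \<otimes> t \<otimes> inv \<rho> c) \<otimes> c = t \<otimes> ?z"
        using \<rho>c vt by (simp_all add: m_assoc)
      ultimately have "N #> (?z \<otimes> t) = N #> (t \<otimes> ?z)"
        by simp
      moreover have "N #> (v \<otimes> ?z) = N #> (t \<otimes> ?z)" "N #> (?z \<otimes> v) = N #> (?z \<otimes> t)"
        using \<rho>c vt t h.hom_mult[of v ?z] h.hom_mult[of t ?z] h.hom_mult[of ?z v] h.hom_mult[of ?z t] by simp_all
      ultimately show ?thesis
        by simp
    qed
    have z: "?z \<in> carrier G"
      using \<rho>c by simp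
    define Q where "Q = {y \<in> carrier G. N #> (y \<otimes> ?z) = N #> (?z \<otimes> y)}"
    have "subgroup Q G"
    proof
      show "Q \<subseteq> carrier G" "\<one> \<in> Q"
        using z by (auto simp: Q_def)
      show "a \<otimes> b \<in> Q" if a: "a \<in> Q" and b: "b \<in> Q" for a b
      proof -
        have ab: "a \<in> carrier G" "b \<in> carrier G"
          using a b by (auto simp: Q_def)
        have "N #> (a \<otimes> b \<otimes> ?z) = N #> (a \<otimes> (?z \<otimes> b))"
          using ab z b h.hom_mult[of a "b \<otimes> ?z"] h.hom_mult[of a "?z \<otimes> b"] by (simp add: Q_def m_assoc)
        also have "\<dots> = N #> (?z \<otimes> a \<otimes> b)"
          using ab z a h.hom_mult[of "a \<otimes> ?z" b] h.hom_mult[of "?z \<otimes> a" b] by (simp add: Q_def m_assoc)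
        finally show ?thesis
          using ab z \<rho>c by (simp add: Q_def m_assoc)
      qed
      show "inv a \<in> Q" if a: "a \<in> Q" for a
      proof -
        have ac: "a \<in> carrier G"
          using a by (simp add: Q_def)
        have "N #> (inv a \<otimes> (a \<otimes> ?z) \<otimes> inv a) = N #> (inv a \<otimes> (?z \<otimes> a) \<otimes> inv a)"
          using a ac z h.hom_mult[of "inv a \<otimes> (a \<otimes> ?z)" "inv a"] h.hom_mult[of "inv a" "a \<otimes> ?z"]
            h.hom_mult[of "inv a \<otimes> (?z \<otimes> a)" "inv a"] h.hom_mult[of "inv a" "?z \<otimes> a"]
          by (simp only: Q_def mem_Collect_eq m_closed inv_closed)
        then show ?thesis
          using ac z \<rho>c by (simp add: Q_def m_assoc)
      qed
    qed
    then have "?D \<subseteq> Q"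
      using zV V by (intro generate_subgroup_incl) (auto simp: Q_def)
    then show ?thesis
      using x by (auto simp: Q_def)
  qed
  define S' where "S' = S \<union> (\<lambda>x. inv x) ` S"
  \<comment> \<open>These are Schreier generators for left multiplication by \<open>S'\<close>; they
    are central modulo \<open>N\<close> by the choice of \<open>\<rho>\<close>.\<close>
  define Z where "Z = (\<lambda>(x, t). inv (\<rho> (x \<otimes> t)) \<otimes> (x \<otimes> t)) ` (S' \<times> R)"
  have S'D: "x \<in> ?D" if "x \<in> S'" for x
    using that S(2) VD subgroup.m_inv_closed[OF Dsub] by (auto simp: S'_def)
  have xtD: "x \<otimes> t \<in> ?D" if "x \<in> S'" "t \<in> R" for x t
    using that S'D R(2) subgroup.m_closed[OF Dsub] by blast
  have zD: "inv (\<rho> c) \<otimes> c \<in> ?D" if "c \<in> ?D" for c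
    using \<rho>(1)[OF that] R(2) that by (intro subgroup.m_closed[OF Dsub] subgroup.m_inv_closed[OF Dsub]) auto
  have "finite Z"
    using S(1) R(1) by (simp add: Z_def S'_def)
  moreover have "Z \<subseteq> ?D"
    using xtD zD by (auto simp: Z_def)
  moreover have "N #> (x \<otimes> z) = N #> (z \<otimes> x)" if "z \<in> Z" "x \<in> ?D" for z x
    using that central xtD by (auto simp: Z_def)
  ultimately have "\<exists>Y r. rank_le Y r \<and> N \<subseteq> Y \<and> Z \<subseteq> Y \<and> (\<forall>x\<in>?D. \<forall>y\<in>Y. x \<otimes> y \<otimes> inv x \<in> Y)"
    by (rule finite_rank_adjoin_central[OF N V])
  then obtain Y r where Y: "rank_le Y r" "N \<subseteq> Y" "Z \<subseteq> Y"
    by blast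
  have Yc: "closed_subgroup Y G T"
    using Y(1) by (simp add: rank_le_def)
  note YD = closed_subgroupD[OF Yc]
  have RG: "R \<subseteq> carrier G"
    using R(2) Dc by blast
  \<comment> \<open>Schreier's rewriting of \<open>x \<otimes> t\<close> as
    \<open>\<rho> (x \<otimes> t)\<close> times an element of \<open>Z\<close> makes
    \<open>R <#> Y\<close> stable under left multiplication by \<open>S'\<close>. Replacing
    \<open>x\<close> by a congruent \<open>v\<close> costs an element of \<open>N\<close>, hence of
    \<open>Y\<close>.\<close>
  have step: "v \<otimes> p \<in> R <#> Y" if x: "x \<in> S'" and v: "v \<in> carrier G" "N #> v = N #> x" and p: "p \<in> R <#> Y" for x v p
  proof -
    from p obtain t y where ty: "t \<in> R" "y \<in> Y" "p = t \<otimes> y"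
      by (rule set_multE)
    define t' where "t' = \<rho> (x \<otimes> t)"
    have c: "x \<in> carrier G" "t \<in> carrier G" "y \<in> carrier G" "t' \<in> carrier G"
      using Dc S'D x ty RG YD(3) \<rho>(1)[OF xtD[OF x ty(1)]] by (auto simp: t'_def)
    have "v \<otimes> inv x \<in> N"
      using rcos_eq_iff[OF N.subgroup_axioms v(1) c(1)] v(2) by simp
    then have "inv t' \<otimes> (v \<otimes> inv x) \<otimes> t' \<in> Y"
      using N.inv_op_closed1[OF c(4)] Y(2) by blast
    moreover have "inv t' \<otimes> (x \<otimes> t) \<in> Y"
      using Y(3) x ty(1) by (auto simp: Z_def t'_def)
    ultimately have "(inv t' \<otimes> (v \<otimes> inv x) \<otimes> t') \<otimes> (inv t' \<otimes> (x \<otimes> t)) \<otimes> y \<in> Y"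
      using YD(5) ty(2) by blast
    moreover have "t' \<in> R"
      using \<rho>(1)[OF xtD[OF x ty(1)]] by (simp add: t'_def)
    ultimately have "t' \<otimes> ((inv t' \<otimes> (v \<otimes> inv x) \<otimes> t') \<otimes> (inv t' \<otimes> (x \<otimes> t)) \<otimes> y) \<in> R <#> Y"
      by (rule set_multI[rotated])
    also have "t' \<otimes> ((inv t' \<otimes> (v \<otimes> inv x) \<otimes> t') \<otimes> (inv t' \<otimes> (x \<otimes> t)) \<otimes> y) = v \<otimes> p"
      using c v ty(3) by (simp add: m_assoc)
    finally show ?thesis .
  qed
  have RYG: "R <#> Y \<subseteq> carrier G"
    using RG YD(3) by (rule setmult_subset_G)
  have "d \<otimes> p \<in> R <#> Y" if "d \<in> ?D" "p \<in> R <#> Y" for d p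
    using that
  proof (induction arbitrary: p rule: generate.induct)
    case one
    then show ?case
      using RYG by auto
  next
    case (incl v)
    obtain x where "x \<in> S" "N #> v = N #> x"
      using S(3)[OF incl(1)] by blast
    then show ?case
      using incl V by (intro step[of x]) (auto simp: S'_def)
  next
    case (inv v)
    obtain x where x: "x \<in> S" "N #> v = N #> x"
      using S(3)[OF inv(1)] by blast
    have "v \<in> carrier G" "x \<in> carrier G"
      using x(1) inv(1) S(2) V by auto
    then have "N #> inv v = N #> inv x"
      using x(2) h.hom_inv[of v] h.hom_inv[of x] by simp
    then show ?case
      using inv V x by (intro step[of "inv x"]) (auto simp: S'_def)
  next
    case (eng d e)
    then have "d \<otimes> (e \<otimes> p) \<in> R <#> Y"
      by blast
    moreover have "d \<in> carrier G" "e \<in> carrier G" "p \<in> carrier G"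
      using eng Dc RYG by auto
    ultimately show ?case
      by (simp add: m_assoc)
  qed
  from this[OF _ set_multI[OF R(3) YD(4)]] have "?D \<subseteq> R <#> Y"
    using Dc by auto
  moreover have "closedin T R"
    using R(1) RG Hausdorff by (intro closedin_Hausdorff_finite) (auto simp: topspace_eq_carrier)
  ultimately have "top_generate G T V \<subseteq> R <#> Y"
    unfolding top_generate_def by (intro closure_of_minimal closedin_set_mult YD(2))
  from rank_le_finite_cover[OF Y(1) closed_subgroup_top_generate[OF V] R(1) RG this]
  show ?thesis by blast
qed

text \<open>The induction needs no separate start: for \<open>I = vars w\<close> the hypothesis of
  \<open>virtually_small_step\<close> on larger sets is void.\<close>

lemma virtually_small_if_covered:
  assumes w: "outer_commutator_word n w" and A: "finite A" and R: "\<And>k. k \<in> A \<Longrightarrow> \<exists>r. rank_le (R k) r"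
    and cover: "word_values G w \<subseteq> (\<Union>k\<in>A. R k)"
    and I: "I \<subseteq> vars w" "I \<noteq> {}"
  shows "virtually_small w I"
  using I
proof (induction "card (vars w - I)" arbitrary: I rule: less_induct)
  case less
  have "virtually_small w (insert j I)" if j: "j \<in> vars w - I" for j
  proof (rule less.hyps)
    show "card (vars w - insert j I) < card (vars w - I)"
      using j by (intro psubset_card_mono) (auto simp: finite_vars)
  qed (use j less.prems in auto)
  then show ?case
    using virtually_small_step[where R = R, OF w A R cover less.prems] by blast
qed

text \<open>Only singletons are needed from the induction: they make a change of one entry by a
  factor in \<open>K\<close> invisible modulo \<open>N\<close>. So values modulo \<open>N\<close>
  are determined by the cosets modulo \<open>K\<close> of all entries, and
  \<open>finite_rank_finite_mod_normal\<close> takes over.\<close>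

lemma finite_rank_verbal_subgroup:
  assumes w: "outer_commutator_word n w" and A: "finite A" and R: "\<And>k. k \<in> A \<Longrightarrow> \<exists>r. rank_le (R k) r"
    and cover: "word_values G w \<subseteq> (\<Union>k\<in>A. R k)"
  shows "\<exists>r. rank_le (verbal_subgroup G T w) r"
proof -
  have "virtually_small w {j}" if "j \<in> vars w" for j
    by (rule virtually_small_if_covered[OF w A R cover]) (use that in auto)
  then obtain K N s where K: "open_normal K" and N: "N \<lhd> G" "rank_le N s"
    and small: "\<And>j. j \<in> vars w \<Longrightarrow> small_on w {j} K N"
    using virtually_small_uniform[OF finite_vars[of w], of w "\<lambda>j. {j}"] by blast
  note KD = open_normalD[OF K]
  obtain S where S: "finite S" "S \<subseteq> carrier G" "\<And>x. x \<in> carrier G \<Longrightarrow> \<exists>t\<in>S. K #> x = K #> t"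
    using finite_transversal[OF K] by blast
  \<comment> \<open>Fixing \<open>\<one>\<close> outside \<open>vars w\<close> makes the set of
    patterns finite.\<close>
  define B where "B = {a. \<forall>j. (j \<in> vars w \<longrightarrow> a j \<in> S) \<and> (j \<notin> vars w \<longrightarrow> a j = \<one>)}"
  have "finite B"
    unfolding B_def by (rule finite_set_of_finite_funs[OF finite_vars S(1)])
  then have fin: "finite ((\<lambda>a. eval_word G a w) ` B)"
    by simp
  have Bc: "a j \<in> carrier G" if "a \<in> B" for a j
    using that S(2) by (cases "j \<in> vars w") (auto simp: B_def)
  show ?thesis
    unfolding verbal_subgroup_def
  proof (rule finite_rank_finite_mod_normal[OF N _ _ fin])
    show "word_values G w \<subseteq> carrier G"
      by (auto simp: word_values_def)
    show "(\<lambda>a. eval_word G a w) ` B \<subseteq> word_values G w"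
      using Bc by (auto simp: word_values_def)
    show "x \<otimes> v \<otimes> inv x \<in> word_values G w" if x: "x \<in> carrier G" and "v \<in> word_values G w" for x v
    proof -
      obtain g where g: "\<And>j. g j \<in> carrier G" "v = eval_word G g w"
        using \<open>v \<in> word_values G w\<close> unfolding word_values_def by blast
      then have "x \<otimes> v \<otimes> inv x = eval_word G (\<lambda>j. x \<otimes> g j \<otimes> inv x) w"
        using x by (simp add: eval_word_conj)
      then show ?thesis
        using g x unfolding word_values_def by blast
    qed
    show "\<exists>t\<in>(\<lambda>a. eval_word G a w) ` B. N #> v = N #> t" if "v \<in> word_values G w" for v
    proof -
      obtain g where g: "\<And>j. g j \<in> carrier G" "v = eval_word G g w"
        using \<open>v \<in> word_values G w\<close> unfolding word_values_def by blast
      have "\<forall>j. \<exists>t\<in>S. K #> g j = K #> t"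
        using S(3) g(1) by blast
      then obtain t where t: "\<And>j. t j \<in> S" "\<And>j. K #> g j = K #> t j"
        by metis
      define a where "a j = (if j \<in> vars w then t j else \<one>)" for j
      have aB: "a \<in> B"
        using t by (simp add: a_def B_def)
      have "N #> v = N #> eval_word G a w"
        unfolding g(2)
      proof (rule eval_word_rcos_cong[OF w N(1) KD(1), of "{}"])
        show "eval_word G g w \<in> N"
          if "j \<in> vars w - {}" "\<And>i. g i \<in> carrier G" "\<And>i. i \<in> {j} \<Longrightarrow> g i \<in> K" for j g
          using small[of j] that unfolding small_on_def by blast
      qed (use g Bc[OF aB] t in \<open>auto simp: a_def\<close>)
      then show ?thesis
        using aB by blast
    qed
  qed
qed

end

theorem theorem1p3:
  fixes G :: "('a, 'b) monoid_scheme" and T :: "'a topology"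
    and w :: gword and n s :: nat and Gs :: "nat \<Rightarrow> 'a set"
  assumes "profinite_group G T"
    and "outer_commutator_word n w"
    and "\<And>i. i \<in> {1..s} \<Longrightarrow> closed_subgroup (Gs i) G T"
    and "word_values G w \<subseteq> (\<Union>i\<in>{1..s}. Gs i)"
    and "\<And>i. i \<in> {1..s} \<Longrightarrow> subgroup_finite_rank (Gs i) G T"
  shows "subgroup_finite_rank (verbal_subgroup G T w) G T"
proof -
  interpret profinite_group G T by fact
  have "\<exists>r. rank_le (Gs i) r" if "i \<in> {1..s}" for i
    using subgroup_finite_rank_iff[OF assms(3)[OF that]] assms(5)[OF that] by simp
  then have "\<exists>r. rank_le (verbal_subgroup G T w) r"
    using assms(4) by (intro finite_rank_verbal_subgroup[OF assms(2), of "{1..s}" Gs]) auto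
  then show ?thesis
    using subgroup_finite_rank_iff[of "verbal_subgroup G T w"] by (auto simp: rank_le_def)
qed

end
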